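(* Let $G$ be a group, $H$ a subgroup of $G$, and $X$ a subset of $G$ such that $G=\langle X\cup H\rangle$. Then $H\hookrightarrow_h (G,X)$ if and only if there exists a strongly bounded relative presentation of $G$ with respect to $X$ and $H$ with linear relative isoperimetric function.
   Context: Convention: generating sets are assumed symmetric (closed under inverses), so $X=X^{-1}$. Hyperbolic embedding. $\Gamma(G,X\sqcup H)$ is the Cayley graph of $G$ with respect to the alphabet $X\sqcup H$, where $X$ and $H$ are regarded as disjoint alphabets (if $x\in X$ and $h\in H$ represent the same element $g$, there are two edges from each vertex $v$ to $vg$, one labelled $x$ and one labelled $h$). Let $\Gamma_H$ be the Cayley graph of $H$ with respect to the generating set $H$, viewed as a complete subgraph of $\Gamma(G,X\sqcup H)$ (vertex set $H$, edges between elements of $H$ labelled by letters from $H$). A path in $\Gamma(G,X\sqcup H)$ is admissible if it contains no edges of $\Gamma_H$ (it may pass through vertices of $\Gamma_H$). For $h_1,h_2\in H$ let $\widehat{d}(h_1,h_2)\in[0,\infty]$ be the length of a shortest admissible path from $h_1$ to $h_2$ ($\infty$ if there is none); this is a metric on $H$. One writes $H\hookrightarrow_h(G,X)$ if (i) $G=\langle X\cup H\rangle$; (ii) $\Gamma(G,X\sqcup H)$ is (Gromov) hyperbolic; (iii) every ball of finite radius in $(H,\widehat{d})$ is finite. Relative presentations. A relative presentation of $G$ with respect to $X$ and $H$ is a presentation $G=\langle H, X\mid \mathcal R\rangle$, meaning that $G=(H*F(X))/\langle\langle\mathcal R\rangle\rangle$ (via the natural map), where $F(X)$ is the free group with basis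 $X$, $\mathcal R$ is a set of elements of $H*F(X)$, written as words in the alphabet $X^{\pm1}\sqcup H$, and $\langle\langle\mathcal R\rangle\rangle$ is the normal closure of $\mathcal R$. It is bounded if the words in $\mathcal R$ have uniformly bounded length in the alphabet $X^{\pm1}\sqcup H$, and strongly bounded if, in addition, the set of letters from $H$ appearing in words from $\mathcal R$ is finite. A function $f:\mathbb N\to\mathbb N$ is a relative isoperimetric function of the presentation if for every $n$ and every word $W$ of length at most $n$ in $X^{\pm1}\sqcup H$ representing $1$ in $G$, there is an equality $W=\prod_{i=1}^k f_i^{-1}R_i^{\pm1}f_i$ in $H*F(X)$ with $f_i\in H*F(X)$, $R_i\in\mathcal R$ and $k\le f(n)$. "Linear relative isoperimetric function" means that one can take $f(n)=Cn$ for some constant $C$. *)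

theory Defs
  imports "HOL-Algebra.Generated_Groups" "HOL-Library.Extended_Nat" "HOL.Hull" "Graph_Theory.Arc_Walk"
begin

section \<open>Hyperbolicity\<close>

definition gromov_product :: "('a \<Rightarrow> 'a \<Rightarrow> real) \<Rightarrow> 'a \<Rightarrow> 'a \<Rightarrow> 'a \<Rightarrow> real" where
  "gromov_product d w x y = (d x w + d y w - d x y) / 2"

definition gromov_hyperbolic :: "'a set \<Rightarrow> ('a \<Rightarrow> 'a \<Rightarrow> real) \<Rightarrow> bool" where
  "gromov_hyperbolic S d \<longleftrightarrow>
    (\<exists>\<delta>\<ge>0. \<forall>w\<in>S. \<forall>x\<in>S. \<forall>y\<in>S. \<forall>z\<in>S.
      min (gromov_product d w x y) (gromov_product d w y z) - \<delta> \<le> gromov_product d w x z)"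

text \<open>The length of a shortest walk from \<open>u\<close> to \<open>v\<close> among those satisfying \<open>P\<close>;
  it is \<open>\<infinity>\<close> if there is none.\<close>

definition walk_dist ::
    "('v, 'e) pre_digraph \<Rightarrow> ('e list \<Rightarrow> bool) \<Rightarrow> 'v \<Rightarrow> 'v \<Rightarrow> enat" where
  "walk_dist D P u v = (INF p\<in>{p. pre_digraph.awalk D u p v \<and> P p}. enat (length p))"

definition graph_dist :: "('v, 'e) pre_digraph \<Rightarrow> 'v \<Rightarrow> 'v \<Rightarrow> enat" where
  "graph_dist D = walk_dist D (\<lambda>_. True)"

text \<open>A connected graph is hyperbolic if its set of vertices, with the path metric, is.
  (The vertices are coarsely dense in the geometric realization, so it makes no difference
  which of these two metric spaces is used.)\<close>

definition hyperbolic_graph :: "('v, 'e) pre_digraph \<Rightarrow> bool" where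
  "hyperbolic_graph D \<longleftrightarrow>
    gromov_hyperbolic (verts D) (\<lambda>u v. real (the_enat (graph_dist D u v)))"


section \<open>Hyperbolically embedded subgroups\<close>

text \<open>The alphabet is the disjoint union \<open>X <+> H\<close>, so an element of \<open>X \<inter> H\<close> gives
  two different arcs out of every vertex. An edge joining \<open>g\<close> to \<open>g \<otimes> a\<close> is represented by its two
  orientations, the arc at \<open>g\<close> with label \<open>a\<close> and the arc at \<open>g \<otimes> a\<close> with label \<open>a\<inverse>\<close>;
  this is the intended undirected graph because \<open>X\<close> is assumed to be closed under inverses,
  and \<open>H\<close> is a subgroup.\<close>

fun letter_value :: "'a + 'a \<Rightarrow> 'a" where
  "letter_value (Inl x) = x"
| "letter_value (Inr h) = h"

definition cayley_graph ::
    "('a, 'm) monoid_scheme \<Rightarrow> 'a set \<Rightarrow> 'a set \<Rightarrow> ('a, 'a \<times> ('a + 'a)) pre_digraph" where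
  "cayley_graph G X H =
    \<lparr> verts = carrier G,
      arcs = carrier G \<times> (X <+> H),
      tail = fst,
      head = (\<lambda>(g, a). g \<otimes>\<^bsub>G\<^esub> letter_value a) \<rparr>"

text \<open>The edges of the complete subgraph \<open>\<Gamma>\<^sub>H\<close>.\<close>

definition subgroup_arcs :: "'a set \<Rightarrow> ('a \<times> ('a + 'a)) set" where
  "subgroup_arcs H = H \<times> Inr ` H"

definition admissible :: "'a set \<Rightarrow> ('a \<times> ('a + 'a)) list \<Rightarrow> bool" where
  "admissible H p \<longleftrightarrow> set p \<inter> subgroup_arcs H = {}"

definition relative_dist ::
    "('a, 'm) monoid_scheme \<Rightarrow> 'a set \<Rightarrow> 'a set \<Rightarrow> 'a \<Rightarrow> 'a \<Rightarrow> enat" where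
  "relative_dist G X H = walk_dist (cayley_graph G X H) (admissible H)"

definition hyperbolically_embedded ::
    "('a, 'm) monoid_scheme \<Rightarrow> 'a set \<Rightarrow> 'a set \<Rightarrow> bool" where
  "hyperbolically_embedded G X H \<longleftrightarrow>
    generate G (X \<union> H) = carrier G \<and>
    hyperbolic_graph (cayley_graph G X H) \<and>
    (\<forall>h\<in>H. \<forall>n::nat. finite {k \<in> H. relative_dist G X H h k \<le> enat n})"


section \<open>Relative presentations\<close>

text \<open>The alphabet \<open>X\<^sup>\<plusminus>\<^sup>1 \<squnion> H\<close>. Here \<open>Gen_inv x\<close> is the formal inverse of the basis element \<open>Gen x\<close>
  of \<open>F(X)\<close>; it differs from \<open>Gen (inv x)\<close> even if \<open>inv x\<close> lies in \<open>X\<close>.\<close>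

datatype 'a rel_letter = Gen 'a | Gen_inv 'a | Sub 'a

definition rel_words :: "'a set \<Rightarrow> 'a set \<Rightarrow> 'a rel_letter list set" where
  "rel_words X H = lists (Gen ` X \<union> Gen_inv ` X \<union> Sub ` H)"

text \<open>\<open>H * F(X)\<close> is the free monoid on the alphabet \<open>X\<^sup>\<plusminus>\<^sup>1 \<squnion> H\<close> modulo free cancellation of the
  letters from \<open>X\<^sup>\<plusminus>\<^sup>1\<close> and the multiplication table of \<open>H\<close>.\<close>

inductive_set free_prod_rel ::
    "('a, 'm) monoid_scheme \<Rightarrow> 'a set \<Rightarrow> 'a set \<Rightarrow> ('a rel_letter list \<times> 'a rel_letter list) set"
  for G (structure) and X H where
  refl: "u \<in> rel_words X H \<Longrightarrow> (u, u) \<in> free_prod_rel G X H"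
| sym: "(u, v) \<in> free_prod_rel G X H \<Longrightarrow> (v, u) \<in> free_prod_rel G X H"
| trans: "(u, v) \<in> free_prod_rel G X H \<Longrightarrow> (v, w) \<in> free_prod_rel G X H
    \<Longrightarrow> (u, w) \<in> free_prod_rel G X H"
| cancel_right: "u \<in> rel_words X H \<Longrightarrow> v \<in> rel_words X H \<Longrightarrow> x \<in> X
    \<Longrightarrow> (u @ [Gen x, Gen_inv x] @ v, u @ v) \<in> free_prod_rel G X H"
| cancel_left: "u \<in> rel_words X H \<Longrightarrow> v \<in> rel_words X H \<Longrightarrow> x \<in> X
    \<Longrightarrow> (u @ [Gen_inv x, Gen x] @ v, u @ v) \<in> free_prod_rel G X H"
| sub_mult: "u \<in> rel_words X H \<Longrightarrow> v \<in> rel_words X H \<Longrightarrow> h \<in> H \<Longrightarrow> k \<in> H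
    \<Longrightarrow> (u @ [Sub h, Sub k] @ v, u @ [Sub (h \<otimes> k)] @ v) \<in> free_prod_rel G X H"
| sub_one: "u \<in> rel_words X H \<Longrightarrow> v \<in> rel_words X H
    \<Longrightarrow> (u @ [Sub \<one>] @ v, u @ v) \<in> free_prod_rel G X H"

lemma rel_words_append: "u @ v \<in> rel_words X H \<longleftrightarrow> u \<in> rel_words X H \<and> v \<in> rel_words X H"
  by (auto simp: rel_words_def)

lemma rel_words_Nil: "[] \<in> rel_words X H"
  by (simp add: rel_words_def)

lemma free_prod_rel_words:
  assumes "subgroup H G" and "(u, v) \<in> free_prod_rel G X H"
  shows "u \<in> rel_words X H \<and> v \<in> rel_words X H"
  using assms(2)
proof induction
  case (sub_mult u v h k)
  then show ?case
    using subgroup.m_closed[OF assms(1)] by (auto simp: rel_words_def)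
next
  case (sub_one u v)
  then show ?case
    using subgroup.one_closed[OF assms(1)] by (auto simp: rel_words_def)
qed (auto simp: rel_words_def)

lemma equiv_free_prod_rel:
  assumes "subgroup H G"
  shows "equiv (rel_words X H) (free_prod_rel G X H)"
proof (rule equivI)
  show "free_prod_rel G X H \<subseteq> rel_words X H \<times> rel_words X H"
    using free_prod_rel_words[OF assms] by auto
  show "refl_on (rel_words X H) (free_prod_rel G X H)"
    by (rule refl_onI) (rule free_prod_rel.refl)
  show "sym_on UNIV (free_prod_rel G X H)"
    by (rule symI) (rule free_prod_rel.sym)
  show "trans_on UNIV (free_prod_rel G X H)"
    by (rule transI) (rule free_prod_rel.trans)
qed

lemma free_prod_rel_append_left:
  assumes "(u, v) \<in> free_prod_rel G X H" and "w \<in> rel_words X H"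
  shows "(w @ u, w @ v) \<in> free_prod_rel G X H"
  using assms
proof induction
  case (cancel_right u v x)
  then show ?case using free_prod_rel.cancel_right[of "w @ u" X H v x G] by (simp add: rel_words_append)
next
  case (cancel_left u v x)
  then show ?case using free_prod_rel.cancel_left[of "w @ u" X H v x G] by (simp add: rel_words_append)
next
  case (sub_mult u v h k)
  then show ?case using free_prod_rel.sub_mult[of "w @ u" X H v h k G] by (simp add: rel_words_append)
next
  case (sub_one u v)
  then show ?case using free_prod_rel.sub_one[of "w @ u" X H v G] by (simp add: rel_words_append)
next
  case (sym u v)
  then show ?case by (metis free_prod_rel.sym)
next
  case (trans u v w')
  then show ?case by (metis free_prod_rel.trans)
qed (simp add: rel_words_append free_prod_rel.refl)

lemma free_prod_rel_append_right:
  assumes "(u, v) \<in> free_prod_rel G X H" and "w \<in> rel_words X H"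
  shows "(u @ w, v @ w) \<in> free_prod_rel G X H"
  using assms
proof induction
  case (cancel_right u v x)
  then show ?case using free_prod_rel.cancel_right[of u X H "v @ w" x G] by (simp add: rel_words_append)
next
  case (cancel_left u v x)
  then show ?case using free_prod_rel.cancel_left[of u X H "v @ w" x G] by (simp add: rel_words_append)
next
  case (sub_mult u v h k)
  then show ?case using free_prod_rel.sub_mult[of u X H "v @ w" h k G] by (simp add: rel_words_append)
next
  case (sub_one u v)
  then show ?case using free_prod_rel.sub_one[of u X H "v @ w" G] by (simp add: rel_words_append)
next
  case (sym u v)
  then show ?case by (metis free_prod_rel.sym)
next
  case (trans u v w')
  then show ?case by (metis free_prod_rel.trans)
qed (simp add: rel_words_append free_prod_rel.refl)

lemma free_prod_rel_append:
  assumes "subgroup H G" "(u, u') \<in> free_prod_rel G X H" "(v, v') \<in> free_prod_rel G X H"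
  shows "(u @ v, u' @ v') \<in> free_prod_rel G X H"
proof (rule free_prod_rel.trans)
  show "(u @ v, u' @ v) \<in> free_prod_rel G X H"
    using free_prod_rel_append_right[OF assms(2)] free_prod_rel_words[OF assms(1,3)] by simp
  show "(u' @ v, u' @ v') \<in> free_prod_rel G X H"
    using free_prod_rel_append_left[OF assms(3)] free_prod_rel_words[OF assms(1,2)] by simp
qed

definition word_class ::
    "('a, 'm) monoid_scheme \<Rightarrow> 'a set \<Rightarrow> 'a set \<Rightarrow> 'a rel_letter list \<Rightarrow> 'a rel_letter list set" where
  "word_class G X H w = free_prod_rel G X H `` {w}"

definition free_prod ::
    "('a, 'm) monoid_scheme \<Rightarrow> 'a set \<Rightarrow> 'a set \<Rightarrow> 'a rel_letter list set monoid" where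
  "free_prod G X H =
    \<lparr> carrier = rel_words X H // free_prod_rel G X H,
      mult = (\<lambda>A B. \<Union>u\<in>A. \<Union>v\<in>B. word_class G X H (u @ v)),
      one = word_class G X H [] \<rparr>"

lemma word_class_eq_iff:
  assumes "subgroup H G" "u \<in> rel_words X H" "v \<in> rel_words X H"
  shows "word_class G X H u = word_class G X H v \<longleftrightarrow> (u, v) \<in> free_prod_rel G X H"
  unfolding word_class_def using equiv_class_eq_iff[OF equiv_free_prod_rel[OF assms(1)]] assms
  by blast

lemma carrier_free_prod: "carrier (free_prod G X H) = word_class G X H ` rel_words X H"
  by (auto simp: free_prod_def quotient_def word_class_def)

lemma mult_free_prod:
  assumes "subgroup H G" "u \<in> rel_words X H" "v \<in> rel_words X H"
  shows "word_class G X H u \<otimes>\<^bsub>free_prod G X H\<^esub> word_class G X H v = word_class G X H (u @ v)"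
proof -
  let ?c = "word_class G X H"
  have eq: "?c (u' @ v') = ?c (u @ v)" if "u' \<in> ?c u" "v' \<in> ?c v" for u' v'
  proof -
    have "(u @ v, u' @ v') \<in> free_prod_rel G X H"
      using that by (intro free_prod_rel_append[OF assms(1)]) (auto simp: word_class_def)
    then show ?thesis
      using word_class_eq_iff[OF assms(1)] free_prod_rel_words[OF assms(1)] by metis
  qed
  have "u \<in> ?c u" "v \<in> ?c v"
    using assms(2,3) by (simp_all add: word_class_def free_prod_rel.refl)
  then have "(\<Union>u'\<in>?c u. \<Union>v'\<in>?c v. ?c (u' @ v')) = (\<Union>u'\<in>?c u. \<Union>v'\<in>?c v. ?c (u @ v))"
    by (intro SUP_cong HOL.refl eq)
  also have "\<dots> = ?c (u @ v)"
    using \<open>u \<in> ?c u\<close> \<open>v \<in> ?c v\<close> by blast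
  finally show ?thesis by (simp add: free_prod_def)
qed

lemma group_free_prod:
  assumes "group G" "subgroup H G"
  shows "group (free_prod G X H)"
proof (rule groupI)
  interpret G: group G by fact
  let ?F = "free_prod G X H" and ?c = "word_class G X H"
  have one: "\<one>\<^bsub>?F\<^esub> = ?c []" by (simp add: free_prod_def)
  show "x \<otimes>\<^bsub>?F\<^esub> y \<in> carrier ?F" if "x \<in> carrier ?F" "y \<in> carrier ?F" for x y
    using that by (auto simp: carrier_free_prod mult_free_prod[OF assms(2)] rel_words_append)
  show "\<one>\<^bsub>?F\<^esub> \<in> carrier ?F" by (simp add: one carrier_free_prod rel_words_Nil)
  show "x \<otimes>\<^bsub>?F\<^esub> y \<otimes>\<^bsub>?F\<^esub> z = x \<otimes>\<^bsub>?F\<^esub> (y \<otimes>\<^bsub>?F\<^esub> z)"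
    if "x \<in> carrier ?F" "y \<in> carrier ?F" "z \<in> carrier ?F" for x y z
    using that by (auto simp: carrier_free_prod mult_free_prod[OF assms(2)] rel_words_append)
  show "\<one>\<^bsub>?F\<^esub> \<otimes>\<^bsub>?F\<^esub> x = x" if "x \<in> carrier ?F" for x
    using that by (auto simp: one carrier_free_prod mult_free_prod[OF assms(2)] rel_words_Nil)
  show "\<exists>y\<in>carrier ?F. y \<otimes>\<^bsub>?F\<^esub> x = \<one>\<^bsub>?F\<^esub>" if x: "x \<in> carrier ?F" for x
  proof -
    obtain u where u: "u \<in> rel_words X H" "x = ?c u" using x by (auto simp: carrier_free_prod)
    have letter: "\<exists>b. [b] \<in> rel_words X H \<and> ([b, a], []) \<in> free_prod_rel G X H"
      if a: "[a] \<in> rel_words X H" for a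
    proof (cases a)
      case (Gen x)
      then show ?thesis using a free_prod_rel.cancel_left[of "[]" X H "[]" x G]
        by (intro exI[of _ "Gen_inv x"]) (auto simp: rel_words_def)
    next
      case (Gen_inv x)
      then show ?thesis using a free_prod_rel.cancel_right[of "[]" X H "[]" x G]
        by (intro exI[of _ "Gen x"]) (auto simp: rel_words_def)
    next
      case (Sub h)
      then have h: "h \<in> H" "inv\<^bsub>G\<^esub> h \<in> H" "h \<in> carrier G"
        using a subgroup.m_inv_closed[OF assms(2)] subgroup.mem_carrier[OF assms(2)]
        by (auto simp: rel_words_def)
      then have "([Sub (inv\<^bsub>G\<^esub> h), Sub h], [Sub \<one>\<^bsub>G\<^esub>]) \<in> free_prod_rel G X H"
        using free_prod_rel.sub_mult[of "[]" X H "[]" "inv\<^bsub>G\<^esub> h" h G]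
        by (simp add: rel_words_Nil)
      moreover have "([Sub \<one>\<^bsub>G\<^esub>], []) \<in> free_prod_rel G X H"
        using free_prod_rel.sub_one[of "[]" X H "[]" G] by (simp add: rel_words_Nil)
      ultimately have "([Sub (inv\<^bsub>G\<^esub> h), Sub h], []) \<in> free_prod_rel G X H"
        by (rule free_prod_rel.trans)
      then show ?thesis using Sub h
        by (intro exI[of _ "Sub (inv\<^bsub>G\<^esub> h)"]) (auto simp: rel_words_def)
    qed
    have "\<exists>v\<in>rel_words X H. (v @ u, []) \<in> free_prod_rel G X H" using u(1)
    proof (induction u)
      case Nil
      then show ?case using free_prod_rel.refl[OF rel_words_Nil] rel_words_Nil by fastforce
    next
      case (Cons a u)
      then have au: "[a] \<in> rel_words X H" "u \<in> rel_words X H" by (auto simp: rel_words_def)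
      then obtain v where v: "v \<in> rel_words X H" "(v @ u, []) \<in> free_prod_rel G X H"
        using Cons.IH by blast
      obtain b where b: "[b] \<in> rel_words X H" "([b, a], []) \<in> free_prod_rel G X H"
        using letter au by blast
      have "(v @ [b, a] @ u, v @ [] @ u) \<in> free_prod_rel G X H"
        using free_prod_rel_append_left[OF free_prod_rel_append_right[OF b(2) au(2)] v(1)] by simp
      from free_prod_rel.trans[OF this] have "(v @ [b, a] @ u, []) \<in> free_prod_rel G X H"
        using v by simp
      then show ?case using v b
        by (intro bexI[of _ "v @ [b]"]) (auto simp: rel_words_append)
    qed
    then obtain v where v: "v \<in> rel_words X H" "(v @ u, []) \<in> free_prod_rel G X H" by blast
    then show ?thesis using u
      by (intro bexI[of _ "?c v"])
        (auto simp: one carrier_free_prod mult_free_prod[OF assms(2)] rel_words_append rel_words_Nil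
          word_class_eq_iff[OF assms(2)])
  qed
qed

fun rel_letter_value :: "('a, 'm) monoid_scheme \<Rightarrow> 'a rel_letter \<Rightarrow> 'a" where
  "rel_letter_value G (Gen x) = x"
| "rel_letter_value G (Gen_inv x) = inv\<^bsub>G\<^esub> x"
| "rel_letter_value G (Sub h) = h"

definition word_value :: "('a, 'm) monoid_scheme \<Rightarrow> 'a rel_letter list \<Rightarrow> 'a" where
  "word_value G w = foldr (\<lambda>a g. rel_letter_value G a \<otimes>\<^bsub>G\<^esub> g) w \<one>\<^bsub>G\<^esub>"

lemma word_value_free_prod_rel:
  assumes "group G" "subgroup H G" "X \<subseteq> carrier G" "(u, v) \<in> free_prod_rel G X H"
  shows "word_value G u = word_value G v"
proof -
  interpret G: group G by fact
  have closed: "word_value G w \<in> carrier G" if "w \<in> rel_words X H" for w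
    using that
  proof (induction w)
    case (Cons a w)
    then show ?case using assms(3) subgroup.mem_carrier[OF assms(2)]
      by (auto simp: rel_words_def word_value_def)
  qed (simp add: word_value_def)
  have append: "word_value G (w @ w') = word_value G w \<otimes>\<^bsub>G\<^esub> word_value G w'"
    if "w \<in> rel_words X H" "w' \<in> rel_words X H" for w w'
    using that
  proof (induction w)
    case Nil
    then show ?case using closed by (auto simp: word_value_def)
  next
    case (Cons a w)
    then have "rel_letter_value G a \<in> carrier G" "w \<in> rel_words X H"
      using assms(3) subgroup.mem_carrier[OF assms(2)] by (auto simp: rel_words_def)
    then show ?case using Cons closed[of w] closed[of w']
      by (auto simp: word_value_def G.m_assoc)
  qed
  have Cons: "word_value G (a # w) = rel_letter_value G a \<otimes>\<^bsub>G\<^esub> word_value G w" for a w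
    by (simp add: word_value_def)
  show ?thesis using assms(4)
  proof induction
    case (cancel_right u v x)
    moreover have "[Gen x, Gen_inv x] @ v \<in> rel_words X H"
      using cancel_right by (auto simp: rel_words_def)
    ultimately show ?case using assms(3) closed[of v]
      by (simp add: append Cons subset_iff flip: G.m_assoc)
  next
    case (cancel_left u v x)
    moreover have "[Gen_inv x, Gen x] @ v \<in> rel_words X H"
      using cancel_left by (auto simp: rel_words_def)
    ultimately show ?case using assms(3) closed[of v]
      by (simp add: append Cons subset_iff flip: G.m_assoc)
  next
    case (sub_mult u v h k)
    moreover have "[Sub h, Sub k] @ v \<in> rel_words X H" "[Sub (h \<otimes>\<^bsub>G\<^esub> k)] @ v \<in> rel_words X H"
      using sub_mult subgroup.m_closed[OF assms(2)] by (auto simp: rel_words_def)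
    ultimately show ?case using subgroup.mem_carrier[OF assms(2)] closed[of v]
      by (simp add: append Cons G.m_assoc)
  next
    case (sub_one u v)
    moreover have "[Sub \<one>\<^bsub>G\<^esub>] @ v \<in> rel_words X H"
      using sub_one subgroup.one_closed[OF assms(2)] by (auto simp: rel_words_def)
    ultimately show ?case using closed[of v] by (simp add: append Cons)
  qed auto
qed

text \<open>The natural map \<open>H * F(X) \<rightarrow> G\<close>; all words in a class have the same value.\<close>

definition natural_map :: "('a, 'm) monoid_scheme \<Rightarrow> 'a rel_letter list set \<Rightarrow> 'a" where
  "natural_map G A = the_elem (word_value G ` A)"

lemma natural_map_word_class:
  assumes "group G" "subgroup H G" "X \<subseteq> carrier G" "w \<in> rel_words X H"
  shows "natural_map G (word_class G X H w) = word_value G w"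
proof -
  have "word_value G ` word_class G X H w = {word_value G w}"
    using assms word_value_free_prod_rel[OF assms(1-3)] free_prod_rel.refl[OF assms(4)]
    by (force simp: word_class_def)
  then show ?thesis by (simp add: natural_map_def)
qed

definition normal_closure :: "('b, 'n) monoid_scheme \<Rightarrow> 'b set \<Rightarrow> 'b set" where
  "normal_closure K S = (\<lambda>N. N \<lhd> K) hull S"

definition relative_presentation ::
    "('a, 'm) monoid_scheme \<Rightarrow> 'a set \<Rightarrow> 'a set \<Rightarrow> 'a rel_letter list set \<Rightarrow> bool" where
  "relative_presentation G X H R \<longleftrightarrow>
    R \<subseteq> rel_words X H \<and>
    natural_map G \<in> epi (free_prod G X H) G \<and>
    kernel (free_prod G X H) G (natural_map G)
      = normal_closure (free_prod G X H) (word_class G X H ` R)"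

definition bounded_presentation :: "'a rel_letter list set \<Rightarrow> bool" where
  "bounded_presentation R \<longleftrightarrow> (\<exists>N. \<forall>r\<in>R. length r \<le> N)"

definition strongly_bounded_presentation :: "'a rel_letter list set \<Rightarrow> bool" where
  "strongly_bounded_presentation R \<longleftrightarrow>
    bounded_presentation R \<and> finite {h. \<exists>r\<in>R. Sub h \<in> set r}"

text \<open>The elements \<open>f\<inverse> r\<^sup>\<plusminus>\<^sup>1 f\<close> of a group \<open>K\<close> with \<open>r \<in> S\<close>.\<close>

definition conjugates_pm :: "('b, 'n) monoid_scheme \<Rightarrow> 'b set \<Rightarrow> 'b set" where
  "conjugates_pm K S =
    {inv\<^bsub>K\<^esub> f \<otimes>\<^bsub>K\<^esub> s \<otimes>\<^bsub>K\<^esub> f | f r s. f \<in> carrier K \<and> r \<in> S \<and> (s = r \<or> s = inv\<^bsub>K\<^esub> r)}"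

definition relative_isoperimetric_function ::
    "('a, 'm) monoid_scheme \<Rightarrow> 'a set \<Rightarrow> 'a set \<Rightarrow> 'a rel_letter list set \<Rightarrow> (nat \<Rightarrow> nat) \<Rightarrow> bool" where
  "relative_isoperimetric_function G X H R f \<longleftrightarrow>
    (\<forall>n. \<forall>W\<in>rel_words X H. length W \<le> n \<and> word_value G W = \<one>\<^bsub>G\<^esub> \<longrightarrow>
      (\<exists>cs. set cs \<subseteq> conjugates_pm (free_prod G X H) (word_class G X H ` R) \<and>
        length cs \<le> f n \<and>
        word_class G X H W = foldr (mult (free_prod G X H)) cs \<one>\<^bsub>free_prod G X H\<^esub>))"

end

theory Submission
  imports Defs
begin

text \<open>From hyperbolicity to a presentation: Dehn's algorithm fills a closed word of length \<open>n\<close> by at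
  most \<open>n\<close> loops of bounded length. A short loop containing an edge \<open>h\<close> of a coset either
  has no other edge in this coset, so that \<open>h\<close> lies in a finite ball of \<open>H\<close>, or it
  splits into two shorter loops. So the relators can be taken to be the short loops whose
  letters from \<open>H\<close> belong to that ball.

  Conversely, no diagrams are needed, because a homological form of the isoperimetric inequality
  suffices. Assigning integers to the edges of the Cayley graph, in such a way that the
  edges within a coset of \<open>H\<close> carry the differences of a function of their endpoints, one obtains an
  additive weight of paths that is invariant under the relations of \<open>H * F(X)\<close>. A closed path of
  nonzero weight therefore needs a relator of nonzero weight in every filling.
  Weights that count crossings of the boundary of a finite ball in \<open>H\<close> give the
  finiteness of the balls of the relative metric; weights that are winding
  numbers around lattice points, with respect to two coordinate functions on the Cayley graph,
  bound the area of a loop from below, and this bounds the sides of the hexagons that are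
  left of a geodesic triangle when its thin corners are cut off.\<close>

section \<open>Linear isoperimetric inequalities imply hyperbolicity\<close>

text \<open>The Cayley graph need not be locally finite, because \<open>H\<close> may be infinite,
  so areas cannot be bounded below by counting vertices. They are measured in the plane instead: the
  image of a relator under two 1-Lipschitz functions is bounded, so it winds around boundedly many
  lattice points. A loop along a side of length \<open>a\<close> whose other long parts stay at
  distance \<open>k\<close> from it winds around about \<open>k * a\<close> lattice points, while
  its filling has only linearly many relators. Hence a constant \<open>k\<close> that is large
  compared with the isoperimetric constant bounds \<open>a\<close>, provided that the rest of the
  loop is not much longer than the side; this is why the longest side of a hexagon is treated. The
  multiplication table of \<open>H\<close> forces weights to be path independent inside a coset, so
  a weight is a difference of vertex values times a multiplicity that is constant on each
  coset.\<close>

locale nat_metric =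
  fixes V :: "'v set" and d :: "'v \<Rightarrow> 'v \<Rightarrow> nat"
  assumes dist_self: "x \<in> V \<Longrightarrow> d x x = 0"
    and dist_sym: "x \<in> V \<Longrightarrow> y \<in> V \<Longrightarrow> d x y = d y x"
    and dist_triangle: "x \<in> V \<Longrightarrow> y \<in> V \<Longrightarrow> z \<in> V \<Longrightarrow> d x z \<le> d x y + d y z"
begin

text \<open>The starting vertex is left out of the list, so that its length counts steps and walks
  compose by \<open>@\<close>. Steps of length 0 are allowed.\<close>

fun walk :: "'v \<Rightarrow> 'v list \<Rightarrow> 'v \<Rightarrow> bool" where
  "walk x [] y \<longleftrightarrow> x = y"
| "walk x (z # zs) y \<longleftrightarrow> z \<in> V \<and> d x z \<le> 1 \<and> walk z zs y"

lemma walk_append: "walk x as y \<Longrightarrow> walk y bs z \<Longrightarrow> walk x (as @ bs) z"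
  by (induction as arbitrary: x) auto

lemma walk_end_mem: "walk x as y \<Longrightarrow> y \<in> set (x # as)"
  by (induction as arbitrary: x) auto

lemma walk_subset: "walk x as y \<Longrightarrow> set as \<subseteq> V"
  by (induction as arbitrary: x) auto

lemma walk_rev:
  assumes "walk x as y" "x \<in> V"
  obtains bs where "walk y bs x" "length bs = length as" "set (y # bs) = set (x # as)"
proof -
  have "\<exists>bs. walk y bs x \<and> length bs = length as \<and> set (y # bs) = set (x # as)"
    using assms
  proof (induction as arbitrary: x)
    case (Cons z as)
    then obtain bs where bs: "walk y bs z" "length bs = length as" "set (y # bs) = set (z # as)"
      by auto
    have "walk z [x] x" using Cons.prems dist_sym by auto
    from walk_append[OF bs(1) this] show ?case
      using bs by (intro exI[of _ "bs @ [x]"]) auto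
  qed auto
  with that show thesis by blast
qed

definition geodesic :: "(nat \<Rightarrow> 'v) \<Rightarrow> nat \<Rightarrow> bool" where
  "geodesic c n \<longleftrightarrow> (\<forall>i\<le>n. c i \<in> V) \<and> (\<forall>i j. i \<le> j \<longrightarrow> j \<le> n \<longrightarrow> d (c i) (c j) = j - i)"

lemma geodesic_mem: "geodesic c n \<Longrightarrow> i \<le> n \<Longrightarrow> c i \<in> V"
  by (simp add: geodesic_def)

lemma geodesic_dist: "geodesic c n \<Longrightarrow> i \<le> j \<Longrightarrow> j \<le> n \<Longrightarrow> d (c i) (c j) = j - i"
  by (simp add: geodesic_def)

lemma geodesic_walk:
  assumes "geodesic c n" "i \<le> j" "j \<le> n"
  obtains as where "walk (c i) as (c j)" "length as = j - i" "set (c i # as) = c ` {i..j}"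
proof -
  have "\<exists>as. walk (c i) as (c j) \<and> length as = j - i \<and> set (c i # as) = c ` {i..j}"
    using assms(2,3)
  proof (induction j rule: dec_induct)
    case base
    show ?case by (intro exI[of _ "[]"]) auto
  next
    case (step m)
    then obtain as where as: "walk (c i) as (c m)" "length as = m - i" "set (c i # as) = c ` {i..m}"
      by auto
    have "walk (c m) [c (Suc m)] (c (Suc m))"
      using step geodesic_mem[OF assms(1)] geodesic_dist[OF assms(1), of m "Suc m"] by auto
    from walk_append[OF as(1) this] show ?case
      using as step by (intro exI[of _ "as @ [c (Suc m)]"]) (auto simp: atLeastAtMostSuc_conv)
  qed
  with that show thesis by blast
qed

definition lipschitz :: "('v \<Rightarrow> nat) \<Rightarrow> bool" where
  "lipschitz f \<longleftrightarrow> (\<forall>x\<in>V. \<forall>y\<in>V. f x \<le> f y + d x y)"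

lemma lipschitz_dist: "x \<in> V \<Longrightarrow> lipschitz (\<lambda>y. d x y)"
  unfolding lipschitz_def using dist_triangle dist_sym by metis

lemma lipschitz_Min:
  assumes "finite I" "I \<noteq> {}" "\<And>i. i \<in> I \<Longrightarrow> lipschitz (f i)"
  shows "lipschitz (\<lambda>x. Min ((\<lambda>i. f i x) ` I))"
  unfolding lipschitz_def
proof (intro ballI)
  fix x y assume xy: "x \<in> V" "y \<in> V"
  have "Min ((\<lambda>i. f i y) ` I) \<in> (\<lambda>i. f i y) ` I" using assms by (intro Min_in) auto
  then obtain i where i: "i \<in> I" "Min ((\<lambda>i. f i y) ` I) = f i y" by auto
  have "Min ((\<lambda>i. f i x) ` I) \<le> f i x" using assms(1) i(1) by (intro Min_le) auto
  also have "\<dots> \<le> f i y + d x y" using assms(3)[OF i(1)] xy by (simp add: lipschitz_def)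
  finally show "Min ((\<lambda>i. f i x) ` I) \<le> Min ((\<lambda>i. f i y) ` I) + d x y" using i by simp
qed

text \<open>A linear isoperimetric inequality: a closed walk is filled by linearly many cells of bounded
  size, each represented by one of its vertices. If the image of the walk in the plane under
  \<open>(f, g)\<close> winds around \<open>(t + 1/2, s + 1/2)\<close>, then so does the image of some cell, which therefore
  comes close to this point. The walk is split into two parts \<open>as\<close> and \<open>bs\<close>; the first crosses the
  line \<open>f = t + 1/2\<close> where \<open>g\<close> is small, and the second only where \<open>g\<close> is large.\<close>

definition linear_filling :: "nat \<Rightarrow> nat \<Rightarrow> bool" where
  "linear_filling K N \<longleftrightarrow>
    (\<forall>p as q bs. p \<in> V \<longrightarrow> walk p as q \<longrightarrow> walk q bs p \<longrightarrow>
      (\<exists>C\<subseteq>V. finite C \<and> card C \<le> K * (length as + length bs) \<and>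
        (\<forall>f g t s. lipschitz f \<longrightarrow> lipschitz g \<longrightarrow> f p \<le> t \<longrightarrow> t < f q \<longrightarrow>
          (\<forall>w\<in>set (p # as). g w < s) \<longrightarrow>
          (\<forall>w\<in>set (q # bs). f w < t \<or> t + 1 < f w \<or> s + 1 < g w) \<longrightarrow>
          (\<exists>v\<in>C. f v \<le> t + N \<and> t \<le> f v + N \<and> g v \<le> s + N \<and> s \<le> g v + N))))"

end

section \<open>Area estimates along the sides of geodesic polygons\<close>

locale geodesic_nat_metric = nat_metric +
  assumes geodesic_exists:
    "x \<in> V \<Longrightarrow> y \<in> V \<Longrightarrow> \<exists>c. geodesic c (d x y) \<and> c 0 = x \<and> c (d x y) = y"
begin

lemma short_walk:
  assumes "x \<in> V" "y \<in> V"
  obtains as where "walk x as y" "length as = d x y"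
    "\<And>w. w \<in> set (x # as) \<Longrightarrow> w \<in> V \<and> d x w + d w y = d x y"
proof -
  obtain c where c: "geodesic c (d x y)" "c 0 = x" "c (d x y) = y"
    using geodesic_exists[OF assms] by blast
  obtain as where as: "walk (c 0) as (c (d x y))" "length as = d x y - 0"
    "set (c 0 # as) = c ` {0..d x y}"
    using geodesic_walk[OF c(1), of 0 "d x y"] by auto
  show thesis
  proof (rule that)
    show "walk x as y" "length as = d x y" using as c by auto
    fix w assume "w \<in> set (x # as)"
    then have "w \<in> c ` {0..d x y}" using as(3) c(2) by blast
    then obtain l where l: "l \<le> d x y" "w = c l" by auto
    then show "w \<in> V \<and> d x w + d w y = d x y"
      using geodesic_mem[OF c(1)] geodesic_dist[OF c(1), of 0 l] geodesic_dist[OF c(1), of l "d x y"] c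
      by auto
  qed
qed

text \<open>The closed walk winds around each lattice point of a rectangle of dimensions roughly
  \<open>k\<close> and \<open>j - i\<close> in the coordinates given by the distances to the side \<open>c ` {i..j}\<close> and to
  its endpoint \<open>c i\<close>.\<close>

lemma side_area:
  assumes fill: "linear_filling K N" and geo: "geodesic c n" and ij: "i \<le> j" "j \<le> n"
    and mem: "u \<in> V" "v \<in> V"
    and conn: "d (c i) u \<le> 4 * k" "d (c j) v \<le> 4 * k"
    and rest: "walk u ts v" "\<And>w l. w \<in> set (u # ts) \<Longrightarrow> l \<in> {i..j} \<Longrightarrow> k \<le> d (c l) w"
  shows "(k - 2) * ((j - i) - 8 * k - 2) \<le> (2 * N + 1)\<^sup>2 * (K * ((j - i) + length ts + 8 * k))"
proof -
  have cV: "c l \<in> V" if "l \<in> {i..j}" for l using that ij geodesic_mem[OF geo] by auto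
  have ci: "c i \<in> V" and cj: "c j \<in> V" using cV ij by auto
  obtain as where as: "walk (c i) as u" "length as = d (c i) u"
    "\<And>w. w \<in> set (c i # as) \<Longrightarrow> w \<in> V \<and> d (c i) w + d w u = d (c i) u"
    using short_walk[OF ci mem(1)] by metis
  obtain bs where bs: "walk v bs (c j)" "length bs = d v (c j)"
    "\<And>w. w \<in> set (v # bs) \<Longrightarrow> w \<in> V \<and> d v w + d w (c j) = d v (c j)"
    using short_walk[OF mem(2) cj] by metis
  obtain ss where ss: "walk (c j) ss (c i)" "length ss = j - i" "set (c j # ss) = c ` {i..j}"
    using geodesic_walk[OF geo ij] walk_rev[OF _ ci] by metis
  let ?ws = "ts @ bs @ ss"
  have ws: "walk u ?ws (c i)" using walk_append rest(1) bs(1) ss(1) by blast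
  obtain C where C: "C \<subseteq> V" "finite C" "card C \<le> K * (length as + length ?ws)"
    and wind: "\<And>f g t s. lipschitz f \<Longrightarrow> lipschitz g \<Longrightarrow> f (c i) \<le> t \<Longrightarrow> t < f u \<Longrightarrow>
          (\<forall>w\<in>set (c i # as). g w < s) \<Longrightarrow>
          (\<forall>w\<in>set (u # ?ws). f w < t \<or> t + 1 < f w \<or> s + 1 < g w) \<Longrightarrow>
          (\<exists>v\<in>C. f v \<le> t + N \<and> t \<le> f v + N \<and> g v \<le> s + N \<and> s \<le> g v + N)"
    using fill[unfolded linear_filling_def, rule_format, OF ci as(1) ws] by metis
  define f where "f = (\<lambda>w. Min ((\<lambda>l. d (c l) w) ` {i..j}))"
  define g where "g = (\<lambda>w. d (c i) w)"
  have lip: "lipschitz f" "lipschitz g"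
    unfolding f_def g_def using ij cV ci by (auto intro!: lipschitz_Min lipschitz_dist)
  have f0: "f w = 0" if "w \<in> c ` {i..j}" for w
  proof -
    from that obtain l where l: "l \<in> {i..j}" "w = c l" by blast
    have "f w \<le> d (c l) w" unfolding f_def using l by (intro Min_le) auto
    then show ?thesis using l cV dist_self by simp
  qed
  have fk: "k \<le> f w" if "w \<in> set (u # ts)" for w
    unfolding f_def using ij that rest(2) by (subst Min_ge_iff) auto
  define box where "box = (\<lambda>v. {f v - N..f v + N} \<times> {g v - N..g v + N})"
  \<comment> \<open>The margin \<open>4 * k\<close> at both ends of the side keeps \<open>s\<close>
    above the values of \<open>g\<close> on \<open>as\<close> and below those on \<open>bs\<close>;
    \<open>t\<close> stays below the lower bound \<open>k\<close> of \<open>f\<close> on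
    \<open>ts\<close>.\<close>
  have sub: "{1..<k - 1} \<times> {4 * k + 1..<(j - i) - 4 * k - 1} \<subseteq> (\<Union>v\<in>C. box v)"
  proof
    fix z assume "z \<in> {1..<k - 1} \<times> {4 * k + 1..<(j - i) - 4 * k - 1}"
    then obtain t s where z: "z = (t, s)" and t: "1 \<le> t" "t + 1 < k"
      and s: "4 * k < s" "s + 1 < (j - i) - 4 * k" by auto
    have "\<exists>v\<in>C. f v \<le> t + N \<and> t \<le> f v + N \<and> g v \<le> s + N \<and> s \<le> g v + N"
    proof (rule wind[OF lip])
      show "f (c i) \<le> t" using f0[of "c i"] ij by auto
      show "t < f u" using fk[of u] t by auto
      show "\<forall>w\<in>set (c i # as). g w < s"
        using as(3) conn s unfolding g_def by force
      \<comment> \<open>On \<open>ts\<close> the value of \<open>f\<close> is too large for a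
        crossing, on the side itself it is 0, and near \<open>c j\<close> the value of
        \<open>g\<close> is too large.\<close>
      show "\<forall>w\<in>set (u # ?ws). f w < t \<or> t + 1 < f w \<or> s + 1 < g w"
      proof
        fix w assume "w \<in> set (u # ?ws)"
        then consider "w \<in> set (u # ts)" | "w \<in> set (v # bs)" | "w \<in> c ` {i..j}"
          using ss(3) by auto
        then show "f w < t \<or> t + 1 < f w \<or> s + 1 < g w"
        proof cases
          case 1 then show ?thesis using fk t by force
        next
          case 2
          then have w: "w \<in> V" "d w (c j) \<le> 4 * k"
            using bs(3)[OF 2] conn dist_sym[OF mem(2) cj] by auto
          have "j - i \<le> d (c i) w + d w (c j)"
            using dist_triangle[OF ci w(1) cj] geodesic_dist[OF geo ij] by simp
          then show ?thesis using w s unfolding g_def by linarith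
        next
          case 3 then show ?thesis using f0 t by auto
        qed
      qed
    qed
    then show "z \<in> (\<Union>v\<in>C. box v)" unfolding box_def z by force
  qed
  have box: "card (box v) \<le> (2 * N + 1)\<^sup>2" for v
    unfolding box_def card_cartesian_product power2_eq_square by (intro mult_le_mono) auto
  have finite_box: "finite (box v)" for v
    unfolding box_def by simp
  have "(k - 2) * ((j - i) - 8 * k - 2) = card ({1..<k - 1} \<times> {4 * k + 1..<(j - i) - 4 * k - 1})"
    by (simp add: card_cartesian_product numeral_2_eq_2 add.commute)
  also have "\<dots> \<le> card (\<Union>v\<in>C. box v)"
    using sub C(2) finite_box by (intro card_mono) auto
  also have "\<dots> \<le> (\<Sum>v\<in>C. card (box v))" using C(2) by (rule card_UN_le)
  also have "\<dots> \<le> card C * (2 * N + 1)\<^sup>2"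
    using sum_bounded_above[of C "\<lambda>v. card (box v)" "(2 * N + 1)\<^sup>2"] box by simp
  also have "\<dots> \<le> (K * ((j - i) + length ts + 8 * k)) * (2 * N + 1)\<^sup>2"
  proof (rule mult_right_mono)
    have "length as + length ?ws \<le> (j - i) + length ts + 8 * k"
      using as(2) bs(2) ss(2) conn dist_sym[OF mem(2) cj] by simp
    then show "card C \<le> K * ((j - i) + length ts + 8 * k)"
      using C(3) by (meson le_trans mult_le_mono2)
  qed simp
  finally show ?thesis by (simp add: mult.commute)
qed

text \<open>For this value of \<open>k\<close>, and for a side of length \<open>a\<close> that is at least half as long as the
  remaining far part of the walk, the estimate of \<open>side_area\<close> becomes
  \<open>6 * (a - 8 * k - 2) \<le> 3 * a + 16 * k\<close>.\<close>

definition side_scale :: "nat \<Rightarrow> nat \<Rightarrow> nat" where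
  "side_scale K N = 6 * ((2 * N + 1)\<^sup>2 * K + 1) + 2"

lemma side_bound:
  assumes "linear_filling K N" "geodesic c n" "i \<le> j" "j \<le> n"
    and k: "k = side_scale K N"
    and "u \<in> V" "v \<in> V" "d (c i) u \<le> 4 * k" "d (c j) v \<le> 4 * k"
    and "walk u ts v" "\<And>w l. w \<in> set (u # ts) \<Longrightarrow> l \<in> {i..j} \<Longrightarrow> k \<le> d (c l) w"
    and len: "length ts \<le> 2 * (j - i) + 8 * k"
  shows "j - i \<le> 23 * k"
proof -
  define Q where "Q = (2 * N + 1)\<^sup>2 * K + 1"
  have Q: "Q > 0" by (simp add: Q_def)
  have k_Q: "k - 2 = 6 * Q" by (simp add: k side_scale_def Q_def)
  have "(k - 2) * ((j - i) - 8 * k - 2) \<le> (2 * N + 1)\<^sup>2 * (K * ((j - i) + length ts + 8 * k))"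
    by (rule side_area) (use assms in auto)
  also have "\<dots> = ((2 * N + 1)\<^sup>2 * K) * ((j - i) + length ts + 8 * k)" by simp
  also have "\<dots> \<le> Q * (3 * (j - i) + 16 * k)"
    unfolding Q_def using len by (intro mult_le_mono) auto
  finally have "Q * (6 * ((j - i) - 8 * k - 2)) \<le> Q * (3 * (j - i) + 16 * k)"
    by (simp add: k_Q mult.commute mult.left_commute)
  then have "6 * ((j - i) - 8 * k - 2) \<le> 3 * (j - i) + 16 * k" using Q by simp
  moreover have "k \<ge> 8" by (simp add: k side_scale_def)
  \<comment> \<open>With \<open>a = j - i\<close>, either the truncated difference vanishes and
    \<open>a \<le> 8 * k + 2\<close>, or \<open>3 * a \<le> 64 * k + 12\<close>; both give
    \<open>a \<le> 23 * k\<close>.\<close>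
  ultimately show ?thesis by linarith
qed

section \<open>Quadrilaterals, hexagons and slim triangles\<close>

lemma geodesic_walk_between:
  assumes "geodesic c n" "i \<le> n" "j \<le> n"
  obtains as where "walk (c i) as (c j)" "length as = max i j - min i j"
    "set (c i # as) = c ` {min i j..max i j}"
proof (cases "i \<le> j")
  case True
  then show ?thesis using geodesic_walk[OF assms(1) True assms(3)] that by (metis max.absorb2 min.absorb1)
next
  case False
  then obtain as where as: "walk (c j) as (c i)" "length as = i - j" "set (c j # as) = c ` {j..i}"
    using geodesic_walk[OF assms(1), of j i] assms by auto
  obtain bs where "walk (c i) bs (c j)" "length bs = length as" "set (c i # bs) = set (c j # as)"
    using walk_rev[OF as(1)] geodesic_mem assms by metis
  then show ?thesis using as False that[of bs] by (auto simp: max_def min_def)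
qed

text \<open>Both ends are close to the same geodesic \<open>B\<close>, so by the triangle inequality
  the segment of \<open>B\<close> between them exceeds the side by at most
  \<open>8 * k\<close>.\<close>

lemma quadrilateral_bound:
  assumes fill: "linear_filling K N" and k: "k = side_scale K N"
    and c: "geodesic c n" "i \<le> j" "j \<le> n"
    and B: "geodesic B m" "a \<le> m" "b \<le> m"
    and conn: "d (c i) (B a) \<le> 4 * k" "d (c j) (B b) \<le> 4 * k"
    and far: "\<And>l r. l \<in> {i..j} \<Longrightarrow> r \<le> m \<Longrightarrow> k \<le> d (c l) (B r)"
  shows "j - i \<le> 23 * k"
proof -
  obtain ts where ts: "walk (B a) ts (B b)" "length ts = max a b - min a b"
    "set (B a # ts) = B ` {min a b..max a b}"
    using geodesic_walk_between[OF B] by blast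
  have mem: "B a \<in> V" "B b \<in> V" "c i \<in> V" "c j \<in> V"
    using geodesic_mem[OF B(1)] geodesic_mem[OF c(1)] B c by auto
  have "d (B a) (B b) = max a b - min a b"
    using geodesic_dist[OF B(1), of a b] geodesic_dist[OF B(1), of b a] dist_sym[OF mem(1,2)] B
    by (cases "a \<le> b") auto
  moreover have "d (B a) (B b) \<le> (j - i) + 8 * k"
    using dist_triangle[OF mem(1,3,2)] dist_triangle[OF mem(3,4,2)] conn dist_sym[OF mem(1,3)]
      geodesic_dist[OF c] by linarith
  ultimately have "length ts \<le> 2 * (j - i) + 8 * k" using ts by simp
  moreover have "k \<le> d (c l) w" if "w \<in> set (B a # ts)" "l \<in> {i..j}" for w l
    using that far B unfolding ts(3) by auto
  ultimately show ?thesis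
    using side_bound[OF fill c k mem(1,2) conn ts(1)] by blast
qed

text \<open>The far part of the loop consists of two sides that are no longer than the given one and
  of a bridge of length at most \<open>2 * k\<close>. A point of the bridge is within
  \<open>k\<close> of one of its ends, so a distance \<open>2 * k\<close> to the sides leaves
  \<open>k\<close> on the bridge.\<close>

lemma hexagon_side_bound:
  assumes fill: "linear_filling K N" and k: "k = side_scale K N"
    and c: "geodesic c n" "i \<le> j" "j \<le> n"
    and as: "p \<in> V" "walk p as q" "length as \<le> j - i"
    and bs: "r \<in> V" "walk r bs s" "length bs \<le> j - i"
    and conn: "d (c i) p \<le> 2 * k" "d q r \<le> 2 * k" "d (c j) s \<le> 2 * k"
    and far: "\<And>w l. w \<in> set (p # as) \<union> set (r # bs) \<Longrightarrow> l \<in> {i..j} \<Longrightarrow> 2 * k \<le> d (c l) w"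
  shows "j - i \<le> 23 * k"
proof -
  have q: "q \<in> set (p # as)" "q \<in> V" using as walk_end_mem walk_subset by fastforce+
  have s: "s \<in> V" using bs walk_end_mem walk_subset by fastforce
  obtain ds where ds: "walk q ds r" "length ds = d q r"
    "\<And>w. w \<in> set (q # ds) \<Longrightarrow> w \<in> V \<and> d q w + d w r = d q r"
    using short_walk[OF q(2) bs(1)] by metis
  have walk: "walk p (as @ ds @ bs) s" using as ds bs walk_append by blast
  have len: "length (as @ ds @ bs) \<le> 2 * (j - i) + 8 * k" using as ds bs conn by simp
  have "k \<le> d (c l) w" if w: "w \<in> set (p # as @ ds @ bs)" and l: "l \<in> {i..j}" for w l
  proof -
    have cl: "c l \<in> V" using l c geodesic_mem[OF c(1)] by auto
    consider "w \<in> set (p # as) \<union> set (r # bs)" | "w \<in> set (q # ds)" using w by auto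
    then show ?thesis
    proof cases
      case 1 then show ?thesis using far[OF 1 l] by simp
    next
      case 2
      then have w: "w \<in> V" "d q w + d w r \<le> 2 * k" using ds(3) conn by force+
      have "2 * k \<le> d (c l) q" "2 * k \<le> d (c l) r" using far[OF _ l] q by auto
      then show ?thesis
        using dist_triangle[OF cl w(1) q(2)] dist_triangle[OF cl w(1) bs(1)] w
          dist_sym[OF w(1) q(2)] by linarith
    qed
  qed
  moreover have "d (c i) p \<le> 4 * k" "d (c j) s \<le> 4 * k" using conn by auto
  ultimately show ?thesis
    using side_bound[OF fill c k as(1) s _ _ walk _ len] by blast
qed

text \<open>If \<open>A\<close> does not approach \<open>B\<close> before the point \<open>A a\<close>, this is a quadrilateral; otherwise
  the corner at \<open>A 0 = B 0\<close> is cut off, and the longest side of the resulting hexagon is bounded.\<close>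

lemma hexagon_bound:
  assumes fill: "linear_filling K N" and k: "k = side_scale K N"
    and c: "geodesic c n" "i \<le> j" "j \<le> n"
    and A: "geodesic A nA" "a \<le> nA" and B: "geodesic B nB" "b \<le> nB" and corner: "A 0 = B 0"
    and conn: "d (c i) (A a) \<le> 2 * k" "d (c j) (B b) \<le> 2 * k"
    and farA: "\<And>l r. l \<in> {i..j} \<Longrightarrow> r \<le> nA \<Longrightarrow> 2 * k \<le> d (c l) (A r)"
    and farB: "\<And>l r. l \<in> {i..j} \<Longrightarrow> r \<le> nB \<Longrightarrow> 2 * k \<le> d (c l) (B r)"
  shows "j - i \<le> 23 * k"
proof -
  have AV: "r \<le> a \<Longrightarrow> A r \<in> V" for r using A geodesic_mem by simp
  have BV: "r \<le> b \<Longrightarrow> B r \<in> V" for r using B geodesic_mem by simp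
  have cV: "r \<le> j \<Longrightarrow> c r \<in> V" for r using c geodesic_mem by simp
  define close where "close = (\<lambda>r. r \<le> a \<and> (\<exists>m\<le>b. d (A r) (B m) \<le> 2 * k))"
  have "close 0" unfolding close_def using corner BV[of 0] dist_self by auto
  moreover have bounded: "\<And>r. close r \<Longrightarrow> r \<le> a" by (simp add: close_def)
  ultimately obtain a1 where a1: "close a1" "\<And>r. close r \<Longrightarrow> r \<le> a1"
    using GreatestI_nat[of close 0 a] Greatest_le_nat[of close _ a] by blast
  then obtain b1 where b1: "b1 \<le> b" "d (A a1) (B b1) \<le> 2 * k" and "a1 \<le> a"
    by (auto simp: close_def)
  show ?thesis
  proof (cases "a1 = a")
    case True
    \<comment> \<open>Here \<open>A a\<close> is itself close to \<open>B\<close>, so the hexagon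
      degenerates: \<open>c i\<close> reaches \<open>B\<close> through \<open>A a\<close> in
      \<open>2 * k + 2 * k\<close>.\<close>
    have "d (c i) (B b1) \<le> 4 * k"
      using dist_triangle[OF cV[OF c(2)] AV[OF order_refl] BV[OF b1(1)]] b1(2) conn(1) True
      by simp
    moreover have "d (c j) (B b) \<le> 4 * k" using conn by simp
    moreover have "k \<le> d (c l) (B r)" if "l \<in> {i..j}" "r \<le> nB" for l r
      using farB[OF that] by simp
    ultimately show ?thesis
      using quadrilateral_bound[OF fill k c B(1) _ B(2)] b1 B(2) by (meson le_trans)
  next
    case False
    then have a1a: "a1 < a" using \<open>a1 \<le> a\<close> by simp
    have farAB: "2 * k \<le> d (A r) (B m)" if r: "r \<in> {a1..a}" and m: "m \<le> b" for r m
    proof (cases "r = a1")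
      case False
      then have "\<not> close r" using a1(2)[of r] r by auto
      then have "\<not> d (A r) (B m) \<le> 2 * k" using r m by (auto simp: close_def)
      then show ?thesis by simp
    next
      \<comment> \<open>The point \<open>A a1\<close> is close to \<open>B\<close>, but its
        successor is not, and one step changes distances by at most 1; integrality saves the bound
        \<open>2 * k\<close>.\<close>
      case True
      have "\<not> close (Suc a1)" using a1(2)[of "Suc a1"] by auto
      then have "\<not> d (A (Suc a1)) (B m) \<le> 2 * k" using a1a m by (auto simp: close_def)
      then have "2 * k < d (A (Suc a1)) (B m)" by simp
      also have "\<dots> \<le> d (A (Suc a1)) (A a1) + d (A a1) (B m)"
        using AV BV a1a m by (intro dist_triangle) auto
      also have "d (A (Suc a1)) (A a1) = 1"
        using geodesic_dist[OF A(1), of a1 "Suc a1"] dist_sym[of "A (Suc a1)" "A a1"] AV a1a A(2)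
        by auto
      finally show ?thesis using True by simp
    qed
    have sym: "d (A r) (c l) = d (c l) (A r)" "d (B m) (c l) = d (c l) (B m)"
        "d (B m) (A r) = d (A r) (B m)"
      if "r \<le> a" "m \<le> b" "l \<le> j" for r m l
      using that AV BV cV dist_sym by auto
    have conn': "d (A a) (c i) \<le> 2 * k" "d (B b) (c j) \<le> 2 * k" "d (B b1) (A a1) \<le> 2 * k"
      using conn b1 sym(1)[OF order_refl le0 c(2)] sym(2)[OF le0 order_refl order_refl]
        sym(3)[OF \<open>a1 \<le> a\<close> b1(1) le0] by simp_all
    obtain cs where cs: "walk (c i) cs (c j)" "length cs = j - i" "set (c i # cs) = c ` {i..j}"
      using geodesic_walk[OF c] by blast
    obtain cs' where cs': "walk (c j) cs' (c i)" "length cs' = j - i" "set (c j # cs') = c ` {i..j}"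
      using walk_rev[OF cs(1) cV[OF c(2)]] cs by metis
    obtain as where as: "walk (A a1) as (A a)" "length as = a - a1" "set (A a1 # as) = A ` {a1..a}"
      using geodesic_walk[OF A(1) less_imp_le[OF a1a] A(2)] by blast
    obtain as' where as': "walk (A a) as' (A a1)" "length as' = a - a1" "set (A a # as') = A ` {a1..a}"
      using walk_rev[OF as(1) AV[OF \<open>a1 \<le> a\<close>]] as by metis
    obtain bs where bs: "walk (B b1) bs (B b)" "length bs = b - b1" "set (B b1 # bs) = B ` {b1..b}"
      using geodesic_walk[OF B(1) b1(1) B(2)] by blast
    note mem = AV[of a] AV[of a1] BV[of b] BV[of b1] cV[of i] cV[of j]
    \<comment> \<open>Any of the three sides can be the longest, and
      \<open>hexagon_side_bound\<close> is applied to that one, since it wants the other two to be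
      no longer.\<close>
    consider "a - a1 \<le> j - i" "b - b1 \<le> j - i" | "j - i \<le> a - a1" "b - b1 \<le> a - a1"
      | "j - i \<le> b - b1" "a - a1 \<le> b - b1" by linarith
    then show ?thesis
    proof cases
      case 1
      show ?thesis
      proof (rule hexagon_side_bound[OF fill k c _ as'(1) _ _ bs(1)])
        show "2 * k \<le> d (c l) w"
          if w: "w \<in> set (A a # as') \<union> set (B b1 # bs)" and l: "l \<in> {i..j}" for w l
        proof -
          have "w \<in> A ` {a1..a} \<union> B ` {b1..b}" using w unfolding as'(3) bs(3) .
          moreover have "{a1..a} \<subseteq> {..nA}" "{b1..b} \<subseteq> {..nB}" using A(2) B(2) by auto
          ultimately show ?thesis using farA[OF l] farB[OF l] by blast
        qed
      qed (use 1 mem as' bs b1 a1a conn in auto)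
    next
      case 2
      have "a - a1 \<le> 23 * k"
      proof (rule hexagon_side_bound[OF fill k A(1) _ A(2) _ bs(1) _ _ cs'(1)])
        show "2 * k \<le> d (A l) w"
          if w: "w \<in> set (B b1 # bs) \<union> set (c j # cs')" and l: "l \<in> {a1..a}" for w l
        proof -
          have l': "l \<le> nA" "l \<le> a" using l A(2) by auto
          consider m where "m \<in> {b1..b}" "w = B m" | m where "m \<in> {i..j}" "w = c m"
            using w unfolding cs'(3) bs(3) by blast
          then show ?thesis
          proof cases
            case 1 then show ?thesis using farAB l by simp
          next
            case 2 then show ?thesis using farA[OF 2(1) l'(1)] sym(1)[OF l'(2) le0, of m] by simp
          qed
        qed
      qed (use 2 mem cs' bs b1 a1a conn conn' c in auto)
      then show ?thesis using 2 by simp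
    next
      case 3
      have "b - b1 \<le> 23 * k"
      proof (rule hexagon_side_bound[OF fill k B(1) _ B(2) _ as(1) _ _ cs(1)])
        show "2 * k \<le> d (B l) w"
          if w: "w \<in> set (A a1 # as) \<union> set (c i # cs)" and l: "l \<in> {b1..b}" for w l
        proof -
          have l': "l \<le> nB" "l \<le> b" using l B(2) by auto
          consider m where "m \<in> {a1..a}" "w = A m" | m where "m \<in> {i..j}" "w = c m"
            using w unfolding cs(3) as(3) by blast
          then show ?thesis
          proof cases
            case 1
            then show ?thesis using farAB[OF 1(1) l'(2)] sym(3)[OF _ l'(2) le0, of m] by simp
          next
            case 2 then show ?thesis using farB[OF 2(1) l'(1)] sym(2)[OF le0 l'(2), of m] by simp
          qed
        qed
      qed (use 3 mem cs as b1 a1a conn conn' c in auto)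
      then show ?thesis using 3 by simp
    qed
  qed
qed

text \<open>A point of \<open>c\<close> far from both other sides lies in a stretch of far points
  whose ends are close to them. This stretch is a side of a quadrilateral or a hexagon, so its
  length is at most \<open>23 * k\<close>; walking to its end and crossing over costs
  \<open>23 * k + 2 * k\<close>.\<close>

lemma slim_triangle:
  assumes fill: "linear_filling K N" and k: "k = side_scale K N"
    and c: "geodesic c n" and A: "geodesic A nA" and B: "geodesic B nB"
    and ends: "c 0 = A nA" "c n = B nB" "A 0 = B 0"
    and q: "q \<le> n"
  shows "(\<exists>m\<le>nA. d (c q) (A m) \<le> 25 * k) \<or> (\<exists>m\<le>nB. d (c q) (B m) \<le> 25 * k)"
proof (rule ccontr)
  assume neg: "\<not> ?thesis"
  have AV: "r \<le> nA \<Longrightarrow> A r \<in> V" for r using A geodesic_mem by simp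
  have BV: "r \<le> nB \<Longrightarrow> B r \<in> V" for r using B geodesic_mem by simp
  have cV: "r \<le> n \<Longrightarrow> c r \<in> V" for r using c geodesic_mem by simp
  define S where "S = A ` {..nA} \<union> B ` {..nB}"
  have SV: "S \<subseteq> V" using AV BV by (auto simp: S_def)
  define close where "close = (\<lambda>r. \<exists>w\<in>S. d (c r) w \<le> 2 * k)"
  have farq: "25 * k < d (c q) w" if "w \<in> S" for w using neg that by (force simp: S_def)
  have "\<not> close q" unfolding close_def using farq by force
  have "close 0" "close n"
    unfolding close_def S_def using ends cV[of 0] cV[of n] dist_self
    by (intro bexI[of _ "A nA"] bexI[of _ "B nB"]; simp)+
  define i where "i = (GREATEST r. r < q \<and> close r)"
  define j where "j = (LEAST r. q < r \<and> close r)"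
  have "q \<noteq> 0" "q \<noteq> n" using \<open>close 0\<close> \<open>close n\<close> \<open>\<not> close q\<close> by metis+
  then have "0 < q \<and> close 0" "q < n \<and> close n" using q \<open>close 0\<close> \<open>close n\<close> by auto
  have i: "i < q \<and> close i" unfolding i_def
    by (rule GreatestI_nat[of "\<lambda>r. r < q \<and> close r" 0 q]) (use \<open>0 < q \<and> close 0\<close> in auto)
  have i_max: "r \<le> i" if "r < q" "close r" for r unfolding i_def
    by (rule Greatest_le_nat[of "\<lambda>r. r < q \<and> close r" r q]) (use that in auto)
  have j: "q < j \<and> close j" unfolding j_def
    by (rule LeastI[of "\<lambda>r. q < r \<and> close r" n]) (use \<open>q < n \<and> close n\<close> in auto)
  have j_min: "j \<le> r" if "q < r" "close r" for r unfolding j_def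
    by (rule Least_le) (use that in auto)
  have jn: "j \<le> n" using j_min \<open>q < n \<and> close n\<close> by blast
  have ij: "i \<le> j" using i j by simp
  have far_open: "2 * k < d (c l) w" if "i < l" "l < j" "w \<in> S" for l w
  proof -
    have "\<not> close l" using that i_max[of l] j_min[of l] \<open>\<not> close q\<close> by (metis linorder_neqE_nat not_le)
    then show ?thesis using that by (auto simp: close_def not_le)
  qed
  \<comment> \<open>The ends \<open>i\<close> and \<open>j\<close> are close points next to far
    ones, so they also keep the distance \<open>2 * k\<close>.\<close>
  have far: "2 * k \<le> d (c l) w" if l: "l \<in> {i..j}" and w: "w \<in> S" for l w
  proof -
    have *: "2 * k \<le> d (c l) w" if "l \<le> n" "i < l'" "l' < j" "d (c l') (c l) \<le> 1" for l'
      using far_open[OF that(2,3) w] dist_triangle[of "c l'" "c l" w] cV that jn w SV by fastforce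
    show ?thesis
    proof (cases "l = i \<or> l = j")
      case False
      then show ?thesis using far_open[OF _ _ w, of l] l by auto
    next
      case True
      then consider "l = i" | "l = j" by blast
      then show ?thesis
      proof cases
        case 1
        then show ?thesis using i j jn *[of "Suc i"] geodesic_dist[OF c, of i "Suc i"]
          dist_sym[of "c i" "c (Suc i)"] cV by force
      next
        case 2
        then show ?thesis using i j jn *[of "j - 1"] geodesic_dist[OF c, of "j - 1" j] by force
      qed
    qed
  qed
  have farA: "2 * k \<le> d (c l) (A r)" if "l \<in> {i..j}" "r \<le> nA" for l r
    using far[OF that(1)] that by (auto simp: S_def)
  have farB: "2 * k \<le> d (c l) (B r)" if "l \<in> {i..j}" "r \<le> nB" for l r
    using far[OF that(1)] that by (auto simp: S_def)
  obtain u v where u: "u \<in> S" "d (c i) u \<le> 2 * k" and v: "v \<in> S" "d (c j) v \<le> 2 * k"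
    using i j unfolding close_def by blast
  have "j - i \<le> 23 * k"
  proof -
    have *: "k \<le> d (c l) (A r)" if "l \<in> {i..j}" "r \<le> nA" for l r using farA[OF that] by simp
    have **: "k \<le> d (c l) (B r)" if "l \<in> {i..j}" "r \<le> nB" for l r using farB[OF that] by simp
    consider a b where "a \<le> nA" "u = A a" "b \<le> nA" "v = A b"
      | a b where "a \<le> nA" "u = A a" "b \<le> nB" "v = B b"
      | a b where "a \<le> nB" "u = B a" "b \<le> nA" "v = A b"
      | a b where "a \<le> nB" "u = B a" "b \<le> nB" "v = B b"
      using u(1) v(1) unfolding S_def by blast
    then show ?thesis
    proof cases
      case 1
      then show ?thesis using quadrilateral_bound[OF fill k c ij jn A, of a b] u v * by simp
    next
      case 2
      then show ?thesis using hexagon_bound[OF fill k c ij jn A _ B, of a b] u v farA farB ends by simp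
    next
      case 3
      then show ?thesis using hexagon_bound[OF fill k c ij jn B _ A, of a b] u v farA farB ends by simp
    next
      case 4
      then show ?thesis using quadrilateral_bound[OF fill k c ij jn B, of a b] u v ** by simp
    qed
  qed
  moreover have "d (c q) (c i) = q - i" using geodesic_dist[OF c, of i q] dist_sym cV i q by simp
  moreover have "d (c q) u \<le> d (c q) (c i) + d (c i) u"
    using dist_triangle cV i q u SV by (meson in_mono le_trans less_imp_le)
  ultimately have "d (c q) u \<le> 25 * k" using u j by linarith
  then show False using farq u by force
qed

text \<open>When triangles are slim, the Gromov product of \<open>x\<close> and \<open>y\<close> at
  \<open>w\<close> is, up to a constant, the distance from \<open>w\<close> to a geodesic from
  \<open>x\<close> to \<open>y\<close> (\<open>upper\<close> and \<open>lower\<close>). The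
  four-point inequality then follows from slimness of the triangle \<open>x\<close>,
  \<open>y\<close>, \<open>z\<close>.\<close>

lemma gromov_hyperbolic_of_filling:
  assumes fill: "linear_filling K N"
  shows "gromov_hyperbolic V (\<lambda>x y. real (d x y))"
proof -
  define \<Delta> where "\<Delta> = 25 * side_scale K N"
  note slim = slim_triangle[OF fill HOL.refl, folded \<Delta>_def]
  define gp where "gp = gromov_product (\<lambda>x y. real (d x y))"
  have gp: "2 * gp w x y = real (d x w) + real (d y w) - real (d x y)" for w x y
    by (simp add: gp_def gromov_product_def)
  have upper: "gp w x y \<le> d w (c i)"
    if V: "w \<in> V" "x \<in> V" "y \<in> V" and c: "geodesic c n" "c 0 = x" "c n = y" "i \<le> n" for w x y c n i
  proof -
    have ci: "c i \<in> V" using c geodesic_mem by blast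
    have "d x y = d x (c i) + d (c i) y"
      using geodesic_dist[OF c(1), of 0 i] geodesic_dist[OF c(1), of i n]
        geodesic_dist[OF c(1), of 0 n] c by simp
    moreover have "d x w \<le> d x (c i) + d w (c i)" "d y w \<le> d (c i) y + d w (c i)"
      using dist_triangle[OF V(2) ci V(1)] dist_triangle[OF V(3) ci V(1)] dist_sym ci V by metis+
    ultimately show ?thesis using gp[of w x y] by linarith
  qed
  have lower: "\<exists>i\<le>n. d w (c i) \<le> gp w x y + 2 * \<Delta> + 1"
    if V: "w \<in> V" "x \<in> V" "y \<in> V" and c: "geodesic c n" "c 0 = x" "c n = y" for w x y c n
  proof -
    obtain A where A: "geodesic A (d w x)" "A 0 = w" "A (d w x) = x"
      using geodesic_exists V by blast
    obtain B where B: "geodesic B (d w y)" "B 0 = w" "B (d w y) = y"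
      using geodesic_exists V by blast
    define P where "P = (\<lambda>i. i \<le> n \<and> (\<exists>m\<le>d w x. d (c i) (A m) \<le> \<Delta>))"
    have P0: "P 0" unfolding P_def using A c V dist_self by auto
    have bounded: "\<And>r. P r \<Longrightarrow> r \<le> n" by (simp add: P_def)
    \<comment> \<open>The last point close to \<open>A\<close>: slimness puts its successor close to
      \<open>B\<close>, so it is close to both sides, at the cost of 1.\<close>
    obtain i where i: "P i" "\<And>r. P r \<Longrightarrow> r \<le> i"
      using GreatestI_nat[of P 0 n] Greatest_le_nat[of P _ n] P0 bounded by blast
    have ci: "c i \<in> V" "i \<le> n" using c(1) geodesic_mem i bounded by blast+
    obtain m where m: "m \<le> d w x" "d (c i) (A m) \<le> \<Delta>" using i by (auto simp: P_def)
    have Am: "A m \<in> V" using A m geodesic_mem by blast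
    have "\<exists>m\<le>d w y. d (c i) (B m) \<le> \<Delta> + 1"
    proof (cases "i = n")
      case True
      then show ?thesis using B(3) c(3) V dist_self by (intro exI[of _ "d w y"]) simp
    next
      case False
      then have lt: "Suc i \<le> n" using ci by simp
      have "\<not> P (Suc i)" using i(2)[of "Suc i"] by auto
      then have "\<not> (\<exists>m\<le>d w x. d (c (Suc i)) (A m) \<le> \<Delta>)" using lt by (auto simp: P_def)
      then obtain m where m: "m \<le> d w y" "d (c (Suc i)) (B m) \<le> \<Delta>"
        using slim[OF c(1) A(1) B(1) _ _ _ lt] A B c by auto
      have "c (Suc i) \<in> V" "B m \<in> V" using c lt B m geodesic_mem by blast+
      from dist_triangle[OF ci(1) this] show ?thesis
        using m geodesic_dist[OF c(1) _ lt, of i] by (intro exI[of _ m]) simp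
    qed
    then obtain l where l: "l \<le> d w y" "d (c i) (B l) \<le> \<Delta> + 1" by blast
    have Bl: "B l \<in> V" using B l geodesic_mem by blast
    have "d w x = d w (A m) + d (A m) x" "d w y = d w (B l) + d (B l) y"
      using geodesic_dist[OF A(1), of 0 m] geodesic_dist[OF A(1) m(1)] A m
        geodesic_dist[OF B(1), of 0 l] geodesic_dist[OF B(1) l(1)] B l by auto
    moreover have "d w (c i) \<le> d w (A m) + d (c i) (A m)" "d w (c i) \<le> d w (B l) + d (c i) (B l)"
      "d (c i) x \<le> d (c i) (A m) + d (A m) x" "d (c i) y \<le> d (c i) (B l) + d (B l) y"
      "d x y \<le> d (c i) x + d (c i) y"
      using dist_triangle[OF V(1) Am ci(1)] dist_triangle[OF V(1) Bl ci(1)]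
        dist_triangle[OF ci(1) Am V(2)] dist_triangle[OF ci(1) Bl V(3)]
        dist_sym[OF Am ci(1)] dist_sym[OF Bl ci(1)] dist_sym[OF ci(1) V(2)]
        dist_triangle[OF V(2) ci(1) V(3)] by auto
    moreover note m(2) l(2) dist_sym[OF V(1,2)] dist_sym[OF V(1,3)]
    ultimately have "2 * d w (c i) + d x y \<le> d x w + d y w + 4 * \<Delta> + 2" by linarith
    then have "d w (c i) \<le> gp w x y + 2 * \<Delta> + 1" using gp[of w x y] by linarith
    then show ?thesis using ci by blast
  qed
  have "min (gp w x y) (gp w y z) - real (3 * \<Delta> + 1) \<le> gp w x z"
    if V: "w \<in> V" "x \<in> V" "y \<in> V" "z \<in> V" for w x y z
  proof -
    obtain c where c: "geodesic c (d x z)" "c 0 = x" "c (d x z) = z"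
      using geodesic_exists V by blast
    obtain A where A: "geodesic A (d y x)" "A 0 = y" "A (d y x) = x"
      using geodesic_exists V by blast
    obtain B where B: "geodesic B (d y z)" "B 0 = y" "B (d y z) = z"
      using geodesic_exists V by blast
    obtain i where i: "i \<le> d x z" "d w (c i) \<le> gp w x z + 2 * \<Delta> + 1"
      using lower[OF V(1,2,4) c] by blast
    have ci: "c i \<in> V" using c i geodesic_mem by blast
    have sym: "gp w y x = gp w x y" using gp[of w x y] gp[of w y x] dist_sym V by simp
    consider m where "m \<le> d y x" "d (c i) (A m) \<le> \<Delta>" | m where "m \<le> d y z" "d (c i) (B m) \<le> \<Delta>"
      using slim[OF c(1) A(1) B(1) _ _ _ i(1)] A B c by auto
    then show ?thesis
    proof cases
      case 1
      then have "A m \<in> V" using A geodesic_mem by blast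
      from dist_triangle[OF V(1) ci this] have "d w (A m) \<le> d w (c i) + \<Delta>" using 1 by simp
      then show ?thesis using upper[OF V(1,3,2) A 1(1)] i sym by linarith
    next
      case 2
      then have "B m \<in> V" using B geodesic_mem by blast
      from dist_triangle[OF V(1) ci this] have "d w (B m) \<le> d w (c i) + \<Delta>" using 2 by simp
      then show ?thesis using upper[OF V(1,3,4) B 2(1)] i by linarith
    qed
  qed
  then show ?thesis
    unfolding gromov_hyperbolic_def gp_def by (intro exI[of _ "real (3 * \<Delta> + 1)"] conjI ballI) auto
qed

end

section \<open>Words over a relative generating set\<close>

lemma rel_words_Cons: "a # w \<in> rel_words X H \<longleftrightarrow> [a] \<in> rel_words X H \<and> w \<in> rel_words X H"
  by (auto simp: rel_words_def)

lemma rel_words_letter: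
  "[Gen x] \<in> rel_words X H \<longleftrightarrow> x \<in> X"
  "[Gen_inv x] \<in> rel_words X H \<longleftrightarrow> x \<in> X"
  "[Sub h] \<in> rel_words X H \<longleftrightarrow> h \<in> H"
  by (auto simp: rel_words_def)

lemma rel_letter_cases:
  assumes "[a] \<in> rel_words X H"
  obtains x where "a = Gen x" "x \<in> X" | x where "a = Gen_inv x" "x \<in> X"
    | h where "a = Sub h" "h \<in> H"
  using assms by (cases a) (auto simp: rel_words_letter)

fun inv_letter :: "('a, 'm) monoid_scheme \<Rightarrow> 'a rel_letter \<Rightarrow> 'a rel_letter" where
  "inv_letter G (Gen x) = Gen_inv x"
| "inv_letter G (Gen_inv x) = Gen x"
| "inv_letter G (Sub h) = Sub (inv\<^bsub>G\<^esub> h)"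

definition inv_word :: "('a, 'm) monoid_scheme \<Rightarrow> 'a rel_letter list \<Rightarrow> 'a rel_letter list" where
  "inv_word G w = rev (map (inv_letter G) w)"

text \<open>The isoperimetric condition for a single word, isolated so that areas of pieces of a
  loop can be added.\<close>

definition area_le ::
    "('a, 'm) monoid_scheme \<Rightarrow> 'a set \<Rightarrow> 'a set \<Rightarrow> 'a rel_letter list set \<Rightarrow> nat \<Rightarrow> 'a rel_letter list \<Rightarrow> bool"
  where "area_le G X H R n w \<longleftrightarrow>
    (\<exists>cs. set cs \<subseteq> conjugates_pm (free_prod G X H) (word_class G X H ` R) \<and> length cs \<le> n \<and>
      word_class G X H w = foldr (mult (free_prod G X H)) cs \<one>\<^bsub>free_prod G X H\<^esub>)"

lemma (in group) foldr_mult_closed: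
  "set cs \<subseteq> carrier G \<Longrightarrow> foldr (mult G) cs \<one> \<in> carrier G"
  by (induction cs) auto

lemma (in group) foldr_mult_append:
  assumes "set cs \<subseteq> carrier G" "set ds \<subseteq> carrier G"
  shows "foldr (mult G) (cs @ ds) \<one> = foldr (mult G) cs \<one> \<otimes> foldr (mult G) ds \<one>"
  using assms foldr_mult_closed by (induction cs) (auto simp: m_assoc)

lemma (in group) conjugates_pm_closed: "S \<subseteq> carrier G \<Longrightarrow> conjugates_pm G S \<subseteq> carrier G"
  by (auto simp: conjugates_pm_def)

lemma (in group) conjugates_pm_conj:
  assumes "S \<subseteq> carrier G" "c \<in> conjugates_pm G S" "u \<in> carrier G"
  shows "inv u \<otimes> c \<otimes> u \<in> conjugates_pm G S"
proof -
  obtain f r s where c: "c = inv f \<otimes> s \<otimes> f" "f \<in> carrier G" "r \<in> S" "s = r \<or> s = inv r"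
    using assms(2) by (auto simp: conjugates_pm_def)
  then have "s \<in> carrier G" using assms(1) by auto
  then have "inv u \<otimes> c \<otimes> u = inv (f \<otimes> u) \<otimes> s \<otimes> (f \<otimes> u)"
    using c assms(3) by (simp add: inv_mult_group m_assoc)
  then show ?thesis using c assms(3) unfolding conjugates_pm_def by blast
qed

lemma (in group) foldr_mult_conj:
  assumes "set cs \<subseteq> carrier G" "u \<in> carrier G"
  shows "foldr (mult G) (map (\<lambda>c. inv u \<otimes> c \<otimes> u) cs) \<one> = inv u \<otimes> foldr (mult G) cs \<one> \<otimes> u"
  using assms
proof (induction cs)
  case (Cons c cs)
  have "foldr (mult G) cs \<one> \<in> carrier G" using Cons.prems foldr_mult_closed by simp
  moreover have "u \<otimes> (inv u \<otimes> y) = y" if "y \<in> carrier G" for y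
    using that Cons.prems by (simp flip: m_assoc)
  ultimately show ?case using Cons by (simp add: m_assoc)
qed simp

locale relative_generation = group G for G (structure) +
  fixes X H :: "'a set"
  assumes subgroup_H: "subgroup H G"
    and X_subset: "X \<subseteq> carrier G"
    and X_inv: "x \<in> X \<Longrightarrow> inv x \<in> X"
    and generates: "generate G (X \<union> H) = carrier G"
begin

abbreviation "words \<equiv> rel_words X H"
abbreviation "val \<equiv> word_value G"
abbreviation "lval \<equiv> rel_letter_value G"
abbreviation "cls \<equiv> word_class G X H"
abbreviation "free_rel \<equiv> free_prod_rel G X H"
abbreviation "FP \<equiv> free_prod G X H"

lemma H_subset: "h \<in> H \<Longrightarrow> h \<in> carrier G"
  using subgroup.mem_carrier[OF subgroup_H] .

lemma H_mult: "h \<in> H \<Longrightarrow> k \<in> H \<Longrightarrow> h \<otimes> k \<in> H"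
  using subgroup.m_closed[OF subgroup_H] .

lemma H_inv: "h \<in> H \<Longrightarrow> inv h \<in> H"
  using subgroup.m_inv_closed[OF subgroup_H] .

lemma H_one: "\<one> \<in> H"
  using subgroup.one_closed[OF subgroup_H] .

lemma mult_mem_H_iff: "h \<in> H \<Longrightarrow> g \<in> carrier G \<Longrightarrow> g \<otimes> h \<in> H \<longleftrightarrow> g \<in> H"
  using H_mult H_inv H_subset
  by (metis inv_solve_right')

lemma lval_closed: "[a] \<in> words \<Longrightarrow> lval a \<in> carrier G"
  using X_subset H_subset by (auto elim!: rel_letter_cases)

lemma val_Nil [simp]: "val [] = \<one>"
  by (simp add: word_value_def)

lemma val_Cons: "val (a # w) = lval a \<otimes> val w"
  by (simp add: word_value_def)

lemma val_closed: "w \<in> words \<Longrightarrow> val w \<in> carrier G"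
proof (induction w)
  case (Cons a w)
  then have "[a] \<in> words" "w \<in> words" using rel_words_Cons[of a w] by auto
  then show ?case using Cons.IH by (simp add: val_Cons lval_closed)
qed simp

lemma val_append: "u \<in> words \<Longrightarrow> v \<in> words \<Longrightarrow> val (u @ v) = val u \<otimes> val v"
proof (induction u)
  case (Cons a u)
  then have "[a] \<in> words" "u \<in> words" using rel_words_Cons[of a u] by auto
  then show ?case using Cons by (simp add: val_Cons m_assoc lval_closed val_closed)
qed (simp add: val_closed)

lemma inv_letter_word: "[a] \<in> words \<Longrightarrow> [inv_letter G a] \<in> words"
  using H_inv by (auto elim!: rel_letter_cases simp: rel_words_letter)

lemma lval_inv_letter: "[a] \<in> words \<Longrightarrow> lval (inv_letter G a) = inv (lval a)"
  using X_subset by (auto elim!: rel_letter_cases)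

lemma inv_word_Cons: "inv_word G (a # w) = inv_word G w @ [inv_letter G a]"
  by (simp add: inv_word_def)

lemma inv_word_Nil [simp]: "inv_word G [] = []"
  by (simp add: inv_word_def)

lemma length_inv_word [simp]: "length (inv_word G w) = length w"
  by (simp add: inv_word_def)

lemma inv_word_words: "w \<in> words \<Longrightarrow> inv_word G w \<in> words"
proof (induction w)
  case (Cons a w)
  then show ?case
    using rel_words_Cons[of a w] inv_letter_word by (auto simp: inv_word_Cons rel_words_append)
qed (simp add: rel_words_Nil)

lemma val_inv_word: "w \<in> words \<Longrightarrow> val (inv_word G w) = inv (val w)"
proof (induction w)
  case (Cons a w)
  then have "[a] \<in> words" "w \<in> words" using rel_words_Cons[of a w] by auto
  then show ?case using Cons.IH
    by (simp add: inv_word_Cons val_append inv_word_words inv_letter_word val_Cons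
        lval_inv_letter inv_mult_group lval_closed val_closed)
qed simp

lemma free_rel_words: "(u, v) \<in> free_rel \<Longrightarrow> u \<in> words \<and> v \<in> words"
  using free_prod_rel_words[OF subgroup_H] .

lemma cls_eq_iff: "u \<in> words \<Longrightarrow> v \<in> words \<Longrightarrow> cls u = cls v \<longleftrightarrow> (u, v) \<in> free_rel"
  using word_class_eq_iff[OF subgroup_H] .

lemma free_rel_context:
  assumes "(u, v) \<in> free_rel" "p \<in> words" "q \<in> words"
  shows "(p @ u @ q, p @ v @ q) \<in> free_rel"
  using free_prod_rel_append_left[OF free_prod_rel_append_right[OF assms(1,3)] assms(2)] .

lemma free_rel_inv_letter:
  assumes "[a] \<in> words"
  shows "([inv_letter G a, a], []) \<in> free_rel"
  using assms
proof (cases rule: rel_letter_cases)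
  case (1 x)
  then show ?thesis using free_prod_rel.cancel_left[of "[]" X H "[]" x G] by (simp add: rel_words_Nil)
next
  case (2 x)
  then show ?thesis using free_prod_rel.cancel_right[of "[]" X H "[]" x G] by (simp add: rel_words_Nil)
next
  case (3 h)
  have "([Sub (inv h), Sub h], [Sub (inv h \<otimes> h)]) \<in> free_rel"
    using free_prod_rel.sub_mult[of "[]" X H "[]" "inv h" h G] 3 H_inv by (simp add: rel_words_Nil)
  moreover have "([Sub \<one>], []) \<in> free_rel"
    using free_prod_rel.sub_one[of "[]" X H "[]" G] by (simp add: rel_words_Nil)
  ultimately show ?thesis using 3 H_subset free_prod_rel.trans by fastforce
qed

lemma free_rel_inv_word_left: "w \<in> words \<Longrightarrow> (inv_word G w @ w, []) \<in> free_rel"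
proof (induction w)
  case Nil
  then show ?case by (simp add: free_prod_rel.refl)
next
  case (Cons a w)
  then have a: "[a] \<in> words" "w \<in> words" using rel_words_Cons[of a w] by auto
  have "(inv_word G w @ [inv_letter G a, a] @ w, inv_word G w @ [] @ w) \<in> free_rel"
    by (intro free_rel_context free_rel_inv_letter inv_word_words a)
  then show ?case using Cons.IH[OF a(2)] free_prod_rel.trans by (fastforce simp: inv_word_Cons)
qed

lemma cls_closed: "w \<in> words \<Longrightarrow> cls w \<in> carrier FP"
  by (simp add: carrier_free_prod)

lemma cls_mult: "u \<in> words \<Longrightarrow> v \<in> words \<Longrightarrow> cls u \<otimes>\<^bsub>FP\<^esub> cls v = cls (u @ v)"
  using mult_free_prod[OF subgroup_H] .

lemma one_FP: "\<one>\<^bsub>FP\<^esub> = cls []"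
  by (simp add: free_prod_def)

lemma group_FP: "group FP"
  using group_free_prod[OF group_axioms subgroup_H] .

lemma cls_inv: "w \<in> words \<Longrightarrow> inv\<^bsub>FP\<^esub> (cls w) = cls (inv_word G w)"
  by (rule group.inv_equality[OF group_FP])
    (simp_all add: cls_closed cls_mult inv_word_words one_FP cls_eq_iff rel_words_append
      rel_words_Nil free_rel_inv_word_left)

lemma free_rel_inv_word_right:
  assumes "w \<in> words"
  shows "(w @ inv_word G w, []) \<in> free_rel"
proof -
  have "cls w \<otimes>\<^bsub>FP\<^esub> inv\<^bsub>FP\<^esub> cls w = \<one>\<^bsub>FP\<^esub>"
    using group.r_inv[OF group_FP] cls_closed assms by blast
  then show ?thesis
    using assms by (simp add: cls_inv cls_mult one_FP cls_eq_iff inv_word_words rel_words_append rel_words_Nil)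
qed

lemma natural_map_cls: "w \<in> words \<Longrightarrow> natural_map G (cls w) = val w"
  using natural_map_word_class[OF group_axioms subgroup_H X_subset] .

lemma word_exists: "g \<in> carrier G \<Longrightarrow> \<exists>w\<in>words. val w = g"
proof -
  assume "g \<in> carrier G"
  then have "g \<in> generate G (X \<union> H)" using generates by simp
  then show ?thesis
  proof induction
    case one
    then show ?case by (intro bexI[of _ "[]"]) (auto simp: rel_words_Nil)
  next
    case (incl h)
    then show ?case
    proof
      assume "h \<in> X"
      then show ?case using X_subset by (intro bexI[of _ "[Gen h]"]) (auto simp: rel_words_letter val_Cons)
    next
      assume "h \<in> H"
      then show ?case using H_subset by (intro bexI[of _ "[Sub h]"]) (auto simp: rel_words_letter val_Cons)
    qed
  next
    case (inv h)
    then show ?case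
    proof
      assume "h \<in> X"
      then show ?case using X_subset
        by (intro bexI[of _ "[Gen_inv h]"]) (auto simp: rel_words_letter val_Cons)
    next
      assume "h \<in> H"
      then show ?case using H_subset H_inv
        by (intro bexI[of _ "[Sub (inv h)]"]) (auto simp: rel_words_letter val_Cons)
    qed
  next
    case (eng g h)
    then show ?case using val_append rel_words_append by metis
  qed
qed

lemma natural_map_epi: "natural_map G \<in> epi FP G"
proof -
  have "natural_map G \<in> hom FP G"
    by (rule homI) (auto simp: carrier_free_prod natural_map_cls val_closed cls_mult rel_words_append val_append)
  moreover have "natural_map G ` carrier FP = val ` words"
    unfolding carrier_free_prod image_image by (rule image_cong) (simp_all add: natural_map_cls)
  moreover have "val ` words = carrier G"
    using word_exists val_closed by blast
  ultimately show ?thesis unfolding epi_def by blast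
qed

lemma group_hom_natural_map: "group_hom FP G (natural_map G)"
  unfolding group_hom_def group_hom_axioms_def
  using natural_map_epi group_FP group_axioms unfolding epi_def by blast

lemma kernel_iff: "w \<in> words \<Longrightarrow> cls w \<in> kernel FP G (natural_map G) \<longleftrightarrow> val w = \<one>"
  by (simp add: kernel_def cls_closed natural_map_cls)

subsection \<open>Areas of words\<close>

lemma area_le_Nil: "area_le G X H R n []"
  unfolding area_le_def by (intro exI[of _ "[]"]) (simp add: one_FP)

lemma area_le_mono: "area_le G X H R m w \<Longrightarrow> m \<le> n \<Longrightarrow> area_le G X H R n w"
  unfolding area_le_def by (meson le_trans)

lemma area_le_cong: "area_le G X H R n u \<Longrightarrow> (u, v) \<in> free_rel \<Longrightarrow> area_le G X H R n v"
  unfolding area_le_def using cls_eq_iff free_rel_words by metis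

context
  fixes R
  assumes R: "R \<subseteq> words"
begin

lemma relator_classes: "cls ` R \<subseteq> carrier FP"
  using R cls_closed by auto

lemma area_le_append:
  assumes "u \<in> words" "v \<in> words" "area_le G X H R m u" "area_le G X H R n v"
  shows "area_le G X H R (m + n) (u @ v)"
proof -
  interpret F: group FP by (rule group_FP)
  obtain cs ds where *: "set cs \<subseteq> conjugates_pm FP (cls ` R)" "length cs \<le> m"
    "cls u = foldr (mult FP) cs \<one>\<^bsub>FP\<^esub>" "set ds \<subseteq> conjugates_pm FP (cls ` R)" "length ds \<le> n"
    "cls v = foldr (mult FP) ds \<one>\<^bsub>FP\<^esub>"
    using assms(3,4) unfolding area_le_def by blast
  have closed: "set cs \<subseteq> carrier FP" "set ds \<subseteq> carrier FP"
    using * F.conjugates_pm_closed[OF relator_classes] by blast+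
  have "cls (u @ v) = foldr (mult FP) (cs @ ds) \<one>\<^bsub>FP\<^esub>"
    unfolding F.foldr_mult_append[OF closed] *(3,6)[symmetric] cls_mult[OF assms(1,2)] ..
  then show ?thesis unfolding area_le_def using * by (intro exI[of _ "cs @ ds"]) auto
qed

lemma area_le_conj:
  assumes "u \<in> words" "w \<in> words" "area_le G X H R n w"
  shows "area_le G X H R n (inv_word G u @ w @ u)"
proof -
  interpret F: group FP by (rule group_FP)
  obtain cs where cs: "set cs \<subseteq> conjugates_pm FP (cls ` R)" "length cs \<le> n"
    "cls w = foldr (mult FP) cs \<one>\<^bsub>FP\<^esub>"
    using assms(3) unfolding area_le_def by blast
  let ?c = "\<lambda>c. inv\<^bsub>FP\<^esub> cls u \<otimes>\<^bsub>FP\<^esub> c \<otimes>\<^bsub>FP\<^esub> cls u"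
  have "cls (inv_word G u @ w @ u) = ?c (cls w)"
    using assms by (simp add: cls_inv cls_mult inv_word_words rel_words_append)
  also have "\<dots> = foldr (mult FP) (map ?c cs) \<one>\<^bsub>FP\<^esub>"
    using F.foldr_mult_conj[of cs "cls u"] F.conjugates_pm_closed[OF relator_classes] cs
      cls_closed[OF assms(1)] by auto
  finally show ?thesis unfolding area_le_def
    using cs F.conjugates_pm_conj[OF relator_classes _ cls_closed[OF assms(1)]]
    by (intro exI[of _ "map ?c cs"]) auto
qed

lemma area_le_rotate:
  assumes "u \<in> words" "v \<in> words" "area_le G X H R n (u @ v)"
  shows "area_le G X H R n (v @ u)"
proof (rule area_le_cong)
  show "area_le G X H R n (inv_word G u @ (u @ v) @ u)"
    using assms by (intro area_le_conj) (auto simp: rel_words_append)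
  show "(inv_word G u @ (u @ v) @ u, v @ u) \<in> free_rel"
    using free_rel_context[OF free_rel_inv_word_left[OF assms(1)] rel_words_Nil, of "v @ u"] assms
    by (simp add: rel_words_append)
qed

lemma area_le_relator:
  assumes "r \<in> R"
  shows "area_le G X H R 1 r"
proof -
  interpret F: group FP by (rule group_FP)
  have r: "cls r \<in> carrier FP" using assms R cls_closed by blast
  have "cls r \<in> conjugates_pm FP (cls ` R)"
    unfolding conjugates_pm_def
    using assms r by (intro CollectI exI[of _ "\<one>\<^bsub>FP\<^esub>"] exI[of _ "cls r"]) simp
  then show ?thesis
    unfolding area_le_def using r by (intro exI[of _ "[cls r]"]) simp
qed

end

subsection \<open>Weights of paths\<close>

text \<open>A discrete line integral of \<open>\<mu>\<close> against the differential of
  \<open>\<phi>\<close>. For indicator functions it is a signed count of crossings of the boundary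
  of a set along selected edges.\<close>

fun weight :: "('a \<Rightarrow> int) \<Rightarrow> ('a \<Rightarrow> 'a rel_letter \<Rightarrow> int) \<Rightarrow> 'a \<Rightarrow> 'a rel_letter list \<Rightarrow> int" where
  "weight \<phi> \<mu> g [] = 0"
| "weight \<phi> \<mu> g (a # w) = (\<phi> (g \<otimes> lval a) - \<phi> g) * \<mu> g a + weight \<phi> \<mu> (g \<otimes> lval a) w"

text \<open>These conditions make weights respect the relations of the free product: backtracking
  along an \<open>X\<close>-edge cancels, and on the edges of one coset of \<open>H\<close> the
  weight is a constant times a difference of \<open>\<phi>\<close>.\<close>

definition edge_function :: "('a \<Rightarrow> 'a rel_letter \<Rightarrow> int) \<Rightarrow> bool" where
  "edge_function \<mu> \<longleftrightarrow>
    (\<forall>g\<in>carrier G. \<forall>x\<in>X. \<mu> g (Gen x) = \<mu> (g \<otimes> x) (Gen_inv x)) \<and>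
    (\<forall>g\<in>carrier G. \<forall>h\<in>H. \<forall>k\<in>H. \<forall>l\<in>H. \<mu> g (Sub h) = \<mu> (g \<otimes> k) (Sub l))"

lemma weight_append:
  "u \<in> words \<Longrightarrow> v \<in> words \<Longrightarrow> g \<in> carrier G \<Longrightarrow>
    weight \<phi> \<mu> g (u @ v) = weight \<phi> \<mu> g u + weight \<phi> \<mu> (g \<otimes> val u) v"
proof (induction u arbitrary: g)
  case (Cons a u)
  then have a: "[a] \<in> words" "u \<in> words" using rel_words_Cons[of a u] by auto
  then show ?case using Cons by (simp add: val_Cons lval_closed val_closed m_assoc)
qed simp

lemma weight_free_rel:
  assumes "(u, v) \<in> free_rel" "edge_function \<mu>" "g \<in> carrier G"
  shows "weight \<phi> \<mu> g u = weight \<phi> \<mu> g v"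
proof -
  \<comment> \<open>Both sides of a relation have the same value, so the suffix is read from the
    same base point and only the replaced subwords must be compared.\<close>
  have local: "weight \<phi> \<mu> g (u @ a @ v) = weight \<phi> \<mu> g (u @ b @ v)"
    if "u \<in> words" "v \<in> words" "a \<in> words" "b \<in> words" "val a = val b" "g \<in> carrier G"
      "\<And>g. g \<in> carrier G \<Longrightarrow> weight \<phi> \<mu> g a = weight \<phi> \<mu> g b" for g u v a b
    using that by (simp add: weight_append rel_words_append val_closed)
  show ?thesis using assms(1,3)
  proof (induction arbitrary: g)
    case (cancel_right u v x)
    have "weight \<phi> \<mu> g (u @ [Gen x, Gen_inv x] @ v) = weight \<phi> \<mu> g (u @ [] @ v)"
    proof (rule local)
      show "weight \<phi> \<mu> g [Gen x, Gen_inv x] = weight \<phi> \<mu> g []" if "g \<in> carrier G" for g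
        using cancel_right assms(2) that X_subset
        by (auto simp: edge_function_def m_assoc subset_iff algebra_simps)
    qed (use cancel_right X_subset in \<open>auto simp: val_Cons rel_words_def\<close>)
    then show ?case by simp
  next
    case (cancel_left u v x)
    have "weight \<phi> \<mu> g (u @ [Gen_inv x, Gen x] @ v) = weight \<phi> \<mu> g (u @ [] @ v)"
    proof (rule local)
      show "weight \<phi> \<mu> g [Gen_inv x, Gen x] = weight \<phi> \<mu> g []" if g: "g \<in> carrier G" for g
      proof -
        have x: "x \<in> carrier G" using cancel_left X_subset by blast
        have "\<mu> (g \<otimes> inv x) (Gen x) = \<mu> (g \<otimes> inv x \<otimes> x) (Gen_inv x)"
          using assms(2) g x cancel_left by (simp add: edge_function_def)
        then show ?thesis using g x by (simp add: m_assoc algebra_simps)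
      qed
    qed (use cancel_left X_subset in \<open>auto simp: val_Cons rel_words_def\<close>)
    then show ?case by simp
  next
    case (sub_mult u v h k)
    show ?case
    proof (rule local)
      show "weight \<phi> \<mu> g [Sub h, Sub k] = weight \<phi> \<mu> g [Sub (h \<otimes> k)]" if g: "g \<in> carrier G" for g
      proof -
        have "\<mu> g (Sub h) = \<mu> (g \<otimes> h) (Sub k)" "\<mu> g (Sub (h \<otimes> k)) = \<mu> (g \<otimes> h) (Sub k)"
          using assms(2) g sub_mult H_mult unfolding edge_function_def by blast+
        then show ?thesis using g H_subset sub_mult by (simp add: m_assoc algebra_simps)
      qed
    qed (use sub_mult H_subset H_mult in \<open>auto simp: val_Cons rel_words_def\<close>)
  next
    case (sub_one u v)
    have "weight \<phi> \<mu> g (u @ [Sub \<one>] @ v) = weight \<phi> \<mu> g (u @ [] @ v)"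
      by (rule local) (use sub_one H_one in \<open>auto simp: val_Cons rel_words_def\<close>)
    then show ?case by simp
  qed auto
qed

lemma weight_inv_word:
  assumes "w \<in> words" "edge_function \<mu>" "g \<in> carrier G"
  shows "weight \<phi> \<mu> (g \<otimes> val w) (inv_word G w) = - weight \<phi> \<mu> g w"
proof -
  have "weight \<phi> \<mu> g (w @ inv_word G w) = weight \<phi> \<mu> g []"
    using assms by (intro weight_free_rel free_rel_inv_word_right)
  then show ?thesis using assms by (simp add: weight_append inv_word_words)
qed

text \<open>Conjugates of relators contribute the weights of translated relators, because conjugation only
  changes the base point. Hence only relators of nonzero weight can fill a word of nonzero weight.\<close>

lemma relator_of_nonzero_weight:
  assumes R: "R \<subseteq> words" "\<And>r. r \<in> R \<Longrightarrow> val r = \<one>"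
    and w: "w \<in> words" "area_le G X H R n w" and g: "g \<in> carrier G"
  obtains L where "L \<subseteq> carrier G \<times> R" "finite L" "card L \<le> n"
    "\<And>\<phi> \<mu>. edge_function \<mu> \<Longrightarrow> weight \<phi> \<mu> g w \<noteq> 0 \<Longrightarrow> \<exists>(h, r)\<in>L. weight \<phi> \<mu> h r \<noteq> 0"
proof -
  obtain cs where cs: "set cs \<subseteq> conjugates_pm FP (cls ` R)" "length cs \<le> n"
    "cls w = foldr (mult FP) cs \<one>\<^bsub>FP\<^esub>"
    using w(2) unfolding area_le_def by blast
  \<comment> \<open>The set \<open>L\<close> is chosen before \<open>\<phi>\<close> and
    \<open>\<mu>\<close>, because later many weights are tested against one and the same
    filling.\<close>
  have "\<exists>L\<subseteq>carrier G \<times> R. finite L \<and> card L \<le> length cs \<and>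
    (\<forall>\<phi> \<mu>. edge_function \<mu> \<longrightarrow> weight \<phi> \<mu> g w \<noteq> 0 \<longrightarrow> (\<exists>(h, r)\<in>L. weight \<phi> \<mu> h r \<noteq> 0))"
    using cs(1,3) w(1)
  proof (induction cs arbitrary: w)
    case Nil
    then have "(w, []) \<in> free_rel" by (simp add: one_FP cls_eq_iff rel_words_Nil)
    then have "weight \<phi> \<mu> g w = 0" if "edge_function \<mu>" for \<phi> \<mu>
      using weight_free_rel[OF _ that g] by fastforce
    then show ?case by (intro exI[of _ "{}"]) auto
  next
    case (Cons c cs)
    interpret F: group FP by (rule group_FP)
    have RF: "cls ` R \<subseteq> carrier FP" using R cls_closed by auto
    have "foldr (mult FP) cs \<one>\<^bsub>FP\<^esub> \<in> carrier FP"
      using F.foldr_mult_closed F.conjugates_pm_closed[OF RF] Cons.prems by (simp add: subset_iff)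
    then obtain v where v: "v \<in> words" "cls v = foldr (mult FP) cs \<one>\<^bsub>FP\<^esub>"
      by (auto simp: carrier_free_prod)
    obtain L where L: "L \<subseteq> carrier G \<times> R" "finite L" "card L \<le> length cs"
      "\<And>\<phi> \<mu>. edge_function \<mu> \<Longrightarrow> weight \<phi> \<mu> g v \<noteq> 0 \<Longrightarrow> \<exists>(h, r)\<in>L. weight \<phi> \<mu> h r \<noteq> 0"
      using Cons.IH[OF _ v(2,1)] Cons.prems by auto
    obtain F r s where c: "c = inv\<^bsub>FP\<^esub> F \<otimes>\<^bsub>FP\<^esub> s \<otimes>\<^bsub>FP\<^esub> F" "F \<in> carrier FP" "r \<in> R"
      "s = cls r \<or> s = inv\<^bsub>FP\<^esub> cls r"
      using Cons.prems(1) by (auto simp: conjugates_pm_def)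
    obtain f where f: "f \<in> words" "F = cls f" using c(2) by (auto simp: carrier_free_prod)
    have r: "r \<in> words" "val r = \<one>" using c(3) R by auto
    obtain r' where r': "r' \<in> words" "s = cls r'" "r' = r \<or> r' = inv_word G r"
      using c(4) r cls_inv inv_word_words by metis
    then have val_r': "val r' = \<one>" using r val_inv_word by auto
    \<comment> \<open>The end of the path \<open>inv_word G f\<close> from \<open>g\<close>, where
      the relator is read; the weights of this path and of \<open>f\<close> cancel.\<close>
    define h where "h = g \<otimes> inv (val f)"
    have h: "h \<in> carrier G" "h \<otimes> val f = g"
      unfolding h_def using g f val_closed by (auto simp: m_assoc)
    have "cls w = cls (inv_word G f @ r' @ f @ v)"
      using Cons.prems(2) c(1) f r' v(1) by (simp add: v(2)[symmetric] cls_inv cls_mult inv_word_words rel_words_append)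
    then have rel: "(w, inv_word G f @ r' @ f @ v) \<in> free_rel"
      using Cons.prems(3) f r' v by (simp add: cls_eq_iff inv_word_words rel_words_append)
    have weight_w: "weight \<phi> \<mu> g w = weight \<phi> \<mu> h r' + weight \<phi> \<mu> g v"
      if \<mu>: "edge_function \<mu>" for \<phi> \<mu>
    proof -
      have "weight \<phi> \<mu> g w = weight \<phi> \<mu> g (inv_word G f @ r' @ f @ v)"
        by (rule weight_free_rel[OF rel \<mu> g])
      also have "\<dots> = weight \<phi> \<mu> g (inv_word G f) + weight \<phi> \<mu> h r' + weight \<phi> \<mu> h f + weight \<phi> \<mu> g v"
        using f r' v g h val_r'
        by (simp add: weight_append inv_word_words rel_words_append val_inv_word flip: h_def)
      also have "weight \<phi> \<mu> g (inv_word G f) = - weight \<phi> \<mu> h f"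
        using weight_inv_word[OF f(1) \<mu> h(1)] h by simp
      finally show ?thesis by simp
    qed
    have weight_r': "weight \<phi> \<mu> h r' \<noteq> 0 \<longleftrightarrow> weight \<phi> \<mu> h r \<noteq> 0" if \<mu>: "edge_function \<mu>" for \<phi> \<mu>
      using r'(3) weight_inv_word[OF r(1) \<mu> h(1)] r h(1) by auto
    show ?case
    proof (intro exI[of _ "insert (h, r) L"] conjI allI impI)
      show "card (insert (h, r) L) \<le> length (c # cs)"
        using L by (simp add: card_insert_if)
      fix \<phi> \<mu> assume *: "edge_function \<mu>" "weight \<phi> \<mu> g w \<noteq> 0"
      then consider "weight \<phi> \<mu> h r \<noteq> 0" | "weight \<phi> \<mu> g v \<noteq> 0"
        using weight_w weight_r' by fastforce
      then show "\<exists>(h, r)\<in>insert (h, r) L. weight \<phi> \<mu> h r \<noteq> 0"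
        by cases (use L(4)[OF *(1)] in auto)
    qed (use L h c in auto)
  qed
  then show thesis using that cs(2) by (meson le_trans)
qed

text \<open>Letters that do not change \<open>\<phi>\<close> contribute 0, and the others telescope.
  Conversely, a closed word of nonzero weight has, for every \<open>c\<close>, a letter at which
  \<open>\<phi>\<close> jumps and \<open>\<mu>\<close> differs from \<open>c\<close>.\<close>

lemma weight_constant:
  assumes "w \<in> words" "g \<in> carrier G"
    and "\<And>u a v. w = u @ a # v \<Longrightarrow>
      \<mu> (g \<otimes> val u) a = c \<or> \<phi> (g \<otimes> val u \<otimes> lval a) = \<phi> (g \<otimes> val u)"
  shows "weight \<phi> \<mu> g w = c * (\<phi> (g \<otimes> val w) - \<phi> g)"
  using assms
proof (induction w arbitrary: g)
  case (Cons a w)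
  have a: "[a] \<in> words" "w \<in> words" using rel_words_Cons[of a w] Cons.prems by auto
  have "weight \<phi> \<mu> (g \<otimes> lval a) w = c * (\<phi> (g \<otimes> lval a \<otimes> val w) - \<phi> (g \<otimes> lval a))"
  proof (rule Cons.IH)
    fix u b v assume w: "w = u @ b # v"
    then have "u \<in> words" using a by (simp add: rel_words_append)
    then show "\<mu> (g \<otimes> lval a \<otimes> val u) b = c \<or>
        \<phi> (g \<otimes> lval a \<otimes> val u \<otimes> lval b) = \<phi> (g \<otimes> lval a \<otimes> val u)"
      using Cons.prems(3)[of "a # u" b v] Cons.prems(2) a w
      by (simp add: val_Cons lval_closed val_closed m_assoc)
  qed (use a Cons.prems lval_closed in auto)
  moreover have "(\<phi> (g \<otimes> lval a) - \<phi> g) * \<mu> g a = c * (\<phi> (g \<otimes> lval a) - \<phi> g)"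
    using Cons.prems(3)[of "[]" a w] Cons.prems(2) by auto
  ultimately show ?case
    using Cons.prems(2) a by (simp add: val_Cons lval_closed val_closed m_assoc right_diff_distrib)
qed simp

subsection \<open>The word metric\<close>

definition wdist :: "'a \<Rightarrow> 'a \<Rightarrow> nat" where
  "wdist u v = (LEAST n. \<exists>w\<in>words. length w = n \<and> u \<otimes> val w = v)"

lemma wdist_word:
  assumes "u \<in> carrier G" "v \<in> carrier G"
  obtains w where "w \<in> words" "length w = wdist u v" "u \<otimes> val w = v"
proof -
  obtain w where w: "w \<in> words" "val w = inv u \<otimes> v"
    using word_exists assms by (metis inv_closed m_closed)
  then have "u \<otimes> val w = v" using assms by (simp flip: m_assoc)
  then have "\<exists>n. \<exists>w\<in>words. length w = n \<and> u \<otimes> val w = v" using w by blast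
  from LeastI_ex[OF this] show thesis using that unfolding wdist_def by blast
qed

lemma wdist_le: "w \<in> words \<Longrightarrow> wdist u (u \<otimes> val w) \<le> length w"
  unfolding wdist_def by (rule Least_le) blast

lemma wdist_self: "u \<in> carrier G \<Longrightarrow> wdist u u = 0"
  using wdist_le[OF rel_words_Nil, of u] by simp

lemma wdist_triangle:
  assumes "x \<in> carrier G" "y \<in> carrier G" "z \<in> carrier G"
  shows "wdist x z \<le> wdist x y + wdist y z"
proof -
  obtain v w where "v \<in> words" "length v = wdist x y" "x \<otimes> val v = y"
    "w \<in> words" "length w = wdist y z" "y \<otimes> val w = z"
    using wdist_word assms by metis
  then show ?thesis
    using wdist_le[of "v @ w" x] assms by (simp add: rel_words_append val_append val_closed flip: m_assoc)
qed

lemma wdist_sym_le: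
  assumes "x \<in> carrier G" "y \<in> carrier G"
  shows "wdist y x \<le> wdist x y"
proof -
  obtain w where w: "w \<in> words" "length w = wdist x y" "x \<otimes> val w = y"
    using wdist_word assms by metis
  then have "y \<otimes> val (inv_word G w) = x"
    using assms val_closed by (simp add: val_inv_word inv_solve_right')
  then show ?thesis using wdist_le[OF inv_word_words[OF w(1)], of y] w by simp
qed

lemma wdist_prefixes:
  assumes "w \<in> words" "x \<in> carrier G" "i \<le> j" "j \<le> length w"
  shows "wdist (x \<otimes> val (take i w)) (x \<otimes> val (take j w)) \<le> j - i"
proof -
  have *: "take j w = take i w @ drop i (take j w)"
    using assms(3) by (metis append_take_drop_id min.absorb1 take_take)
  have w: "take i w \<in> words" "drop i (take j w) \<in> words"
    using assms(1) * append_take_drop_id[of j w] rel_words_append by metis+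
  have "x \<otimes> val (take j w) = x \<otimes> val (take i w) \<otimes> val (drop i (take j w))"
    using assms(2) w val_closed by (subst *) (simp add: val_append m_assoc)
  then show ?thesis using wdist_le[OF w(2), of "x \<otimes> val (take i w)"] assms(4) by simp
qed

lemma take_words: "w \<in> words \<Longrightarrow> take i w \<in> words"
  using append_take_drop_id[of i w] rel_words_append by metis

text \<open>The prefixes of a shortest word trace a geodesic.\<close>

sublocale cayley: geodesic_nat_metric "carrier G" wdist
proof
  fix x y z assume xyz: "x \<in> carrier G" "y \<in> carrier G"
  show "wdist x y = wdist y x" using wdist_sym_le xyz by (simp add: antisym)
next
  fix x y assume xy: "x \<in> carrier G" "y \<in> carrier G"
  then obtain w where w: "w \<in> words" "length w = wdist x y" "x \<otimes> val w = y"
    using wdist_word by metis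
  define c where "c = (\<lambda>i. x \<otimes> val (take i w))"
  have c: "c i \<in> carrier G" for i using take_words[OF w(1)] xy val_closed by (simp add: c_def)
  have c0: "c 0 = x" "c (wdist x y) = y" using xy w by (simp_all add: c_def)
  have le: "wdist (c i) (c j) \<le> j - i" if "i \<le> j" "j \<le> wdist x y" for i j
    using wdist_prefixes[OF w(1) xy(1) that(1)] that w by (simp add: c_def)
  have "wdist (c i) (c j) = j - i" if ij: "i \<le> j" "j \<le> wdist x y" for i j
  proof (rule antisym[OF le[OF ij]])
    have "wdist x y \<le> wdist x (c i) + wdist (c i) y"
      "wdist (c i) y \<le> wdist (c i) (c j) + wdist (c j) y"
      using wdist_triangle xy c by blast+
    moreover have "wdist x (c i) \<le> i" using le[of 0 i] ij c0 by simp
    moreover have "wdist (c j) y \<le> wdist x y - j" using le[of j "wdist x y"] ij c0 by simp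
    ultimately show "j - i \<le> wdist (c i) (c j)" using ij by linarith
  qed
  moreover have "nat_metric (carrier G) wdist"
    by unfold_locales (use wdist_self wdist_triangle wdist_sym_le in \<open>auto simp: antisym\<close>)
  ultimately show "\<exists>c. nat_metric.geodesic (carrier G) wdist c (wdist x y) \<and> c 0 = x \<and> c (wdist x y) = y"
    using c c0 by (intro exI[of _ c]) (simp add: nat_metric.geodesic_def)
qed (use wdist_self wdist_triangle in auto)

subsection \<open>Walks in the Cayley graph\<close>

text \<open>\<open>Gen_inv x\<close> and \<open>Gen (inv x)\<close> share an arc, which exists
  because \<open>X\<close> is closed under inverses. So several words can trace one path, and
  \<open>awalk_word\<close> picks one of them.\<close>

fun arc_letter :: "'a rel_letter \<Rightarrow> 'a + 'a" where
  "arc_letter (Gen x) = Inl x"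
| "arc_letter (Gen_inv x) = Inl (inv x)"
| "arc_letter (Sub h) = Inr h"

fun word_path :: "'a \<Rightarrow> 'a rel_letter list \<Rightarrow> ('a \<times> ('a + 'a)) list" where
  "word_path g [] = []"
| "word_path g (a # w) = (g, arc_letter a) # word_path (g \<otimes> lval a) w"

abbreviation "\<Gamma> \<equiv> cayley_graph G X H"

lemma length_word_path [simp]: "length (word_path g w) = length w"
  by (induction w arbitrary: g) auto

lemma awalk_word_path:
  assumes "w \<in> words" "g \<in> carrier G"
  shows "pre_digraph.awalk \<Gamma> g (word_path g w) (g \<otimes> val w)"
  using assms
proof (induction w arbitrary: g)
  case Nil
  then show ?case by (simp add: pre_digraph.awalk_def pre_digraph.cas.simps cayley_graph_def)
next
  case (Cons a w)
  have a: "[a] \<in> words" "w \<in> words" using rel_words_Cons[of a w] Cons.prems by auto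
  have "arc_letter a \<in> X <+> H" "letter_value (arc_letter a) = lval a"
    using a(1) X_inv by (auto elim!: rel_letter_cases)
  then show ?case
    using Cons.IH[OF a(2), of "g \<otimes> lval a"] Cons.prems(2) a
    by (simp add: pre_digraph.awalk_def pre_digraph.cas.simps cayley_graph_def val_Cons
        lval_closed val_closed m_assoc)
qed

lemma awalk_word:
  assumes "pre_digraph.awalk \<Gamma> u p v"
  obtains w where "w \<in> words" "p = word_path u w" "u \<otimes> val w = v" "u \<in> carrier G"
proof -
  have "\<exists>w\<in>words. p = word_path u w \<and> u \<otimes> val w = v \<and> u \<in> carrier G" using assms
  proof (induction p arbitrary: u)
    case Nil
    then show ?case
      by (intro bexI[of _ "[]"])
        (auto simp: pre_digraph.awalk_def pre_digraph.cas.simps cayley_graph_def rel_words_Nil)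
  next
    case (Cons e p)
    define b where "b = snd e"
    have "e \<in> carrier G \<times> (X <+> H)" "fst e = u" and u: "u \<in> carrier G"
      and p: "set p \<subseteq> arcs \<Gamma>" "pre_digraph.cas \<Gamma> (u \<otimes> letter_value b) p v"
      using Cons.prems
      by (simp_all add: pre_digraph.awalk_def pre_digraph.cas.simps cayley_graph_def b_def case_prod_beta) auto
    then have e: "e = (u, b)" "b \<in> X <+> H" by (auto simp: b_def)
    obtain a where a: "[a] \<in> words" "b = arc_letter a" "letter_value b = lval a"
    proof (cases b)
      case (Inl x)
      then show ?thesis using that[of "Gen x"] e by (auto simp: rel_words_letter)
    next
      case (Inr h)
      then show ?thesis using that[of "Sub h"] e by (auto simp: rel_words_letter)
    qed
    have "pre_digraph.awalk \<Gamma> (u \<otimes> lval a) p v"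
      using p u a by (simp add: pre_digraph.awalk_def cayley_graph_def lval_closed)
    then obtain w where w: "w \<in> words" "p = word_path (u \<otimes> lval a) w" "u \<otimes> lval a \<otimes> val w = v"
      using Cons.IH by blast
    then show ?case using e a u rel_words_Cons[of a w]
      by (intro bexI[of _ "a # w"]) (auto simp: val_Cons m_assoc lval_closed val_closed)
  qed
  then show thesis using that by blast
qed

lemma set_word_path:
  assumes "w \<in> words" "g \<in> carrier G"
  shows "set (word_path g w) = {(g \<otimes> val u, arc_letter a) | u a v. w = u @ a # v}"
  using assms
proof (induction w arbitrary: g)
  case (Cons a w)
  have a: "[a] \<in> words" "w \<in> words" using rel_words_Cons[of a w] Cons.prems by auto
  have "{(g \<otimes> val u, arc_letter b) | u b v. a # w = u @ b # v} =
    insert (g, arc_letter a) {(g \<otimes> val (a # u), arc_letter b) | u b v. w = u @ b # v}"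
    using Cons.prems(2) by (auto simp: Cons_eq_append_conv)
      (metis r_one val_Nil | blast)+
  also have "{(g \<otimes> val (a # u), arc_letter b) | u b v. w = u @ b # v} =
    {(g \<otimes> lval a \<otimes> val u, arc_letter b) | u b v. w = u @ b # v}"
  proof -
    have "g \<otimes> val (a # u) = g \<otimes> lval a \<otimes> val u" if "w = u @ b # v" for u b v
      using that a Cons.prems(2) by (simp add: rel_words_append val_Cons m_assoc lval_closed val_closed)
    then show ?thesis by (metis (no_types, lifting))
  qed
  finally show ?case using Cons.IH[OF a(2), of "g \<otimes> lval a"] Cons.prems a by (simp add: lval_closed)
qed simp

lemma admissible_word_path_iff:
  assumes "w \<in> words" "g \<in> carrier G"
  shows "admissible H (word_path g w) \<longleftrightarrow> (\<forall>u h v. w = u @ Sub h # v \<longrightarrow> g \<otimes> val u \<notin> H)"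
proof -
  have mem_iff: "arc_letter a \<in> Inr ` H \<longleftrightarrow> (\<exists>h. a = Sub h)" if w: "w = u @ a # v" for u a v
  proof -
    have "[a] \<in> words"
      using assms(1) unfolding w rel_words_append using rel_words_Cons[of a v X H] by blast
    then show ?thesis by (auto elim!: rel_letter_cases)
  qed
  have "admissible H (word_path g w) \<longleftrightarrow>
    (\<forall>u a v. w = u @ a # v \<longrightarrow> arc_letter a \<in> Inr ` H \<longrightarrow> g \<otimes> val u \<notin> H)"
    unfolding admissible_def subgroup_arcs_def set_word_path[OF assms] by blast
  also have "\<dots> \<longleftrightarrow> (\<forall>u h v. w = u @ Sub h # v \<longrightarrow> g \<otimes> val u \<notin> H)"
    using mem_iff by blast
  finally show ?thesis .
qed

lemma graph_dist_eq:
  assumes "u \<in> carrier G" "v \<in> carrier G"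
  shows "graph_dist \<Gamma> u v = enat (wdist u v)"
  unfolding graph_dist_def walk_dist_def
proof (rule antisym)
  obtain w where "w \<in> words" "length w = wdist u v" "u \<otimes> val w = v"
    using wdist_word assms by metis
  then show "(INF p\<in>{p. pre_digraph.awalk \<Gamma> u p v \<and> True}. enat (length p)) \<le> enat (wdist u v)"
    using awalk_word_path[of w u] assms by (intro INF_lower2[of "word_path u w"]) auto
  show "enat (wdist u v) \<le> (INF p\<in>{p. pre_digraph.awalk \<Gamma> u p v \<and> True}. enat (length p))"
    by (rule INF_greatest) (auto elim!: awalk_word intro: wdist_le)
qed

lemma hyperbolic_graph_iff:
  "hyperbolic_graph \<Gamma> \<longleftrightarrow> gromov_hyperbolic (carrier G) (\<lambda>u v. real (wdist u v))"
proof -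
  have "verts \<Gamma> = carrier G" by (simp add: cayley_graph_def)
  then show ?thesis
    unfolding hyperbolic_graph_def gromov_hyperbolic_def gromov_product_def
    by (simp add: graph_dist_eq)
qed

lemma relative_dist_le_iff:
  assumes "g \<in> carrier G"
  shows "relative_dist G X H g k \<le> enat n \<longleftrightarrow>
    (\<exists>w\<in>words. length w \<le> n \<and> g \<otimes> val w = k \<and> (\<forall>u h v. w = u @ Sub h # v \<longrightarrow> g \<otimes> val u \<notin> H))"
    (is "?L \<longleftrightarrow> ?R")
proof
  assume ?R
  then obtain w where w: "w \<in> words" "length w \<le> n" "g \<otimes> val w = k"
    "\<forall>u h v. w = u @ Sub h # v \<longrightarrow> g \<otimes> val u \<notin> H" by blast
  then show ?L unfolding relative_dist_def walk_dist_def
    using awalk_word_path[OF w(1) assms] admissible_word_path_iff[OF w(1) assms]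
    by (intro INF_lower2[of "word_path g w"]) auto
next
  assume L: ?L
  show ?R
  proof (rule ccontr)
    assume neg: "\<not> ?R"
    have "enat (Suc n) \<le> relative_dist G X H g k"
      unfolding relative_dist_def walk_dist_def
    proof (rule INF_greatest)
      fix p assume "p \<in> {p. pre_digraph.awalk \<Gamma> g p k \<and> admissible H p}"
      then have p: "pre_digraph.awalk \<Gamma> g p k" "admissible H p" by auto
      obtain w where w: "w \<in> words" "p = word_path g w" "g \<otimes> val w = k"
        using awalk_word[OF p(1)] by blast
      then have "\<not> length w \<le> n" using neg p(2) admissible_word_path_iff[OF w(1) assms] by blast
      then show "enat (Suc n) \<le> enat (length p)" using w by simp
    qed
    then have "enat (Suc n) \<le> enat n" using L by (rule order_trans)
    then show False by simp
  qed
qed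

section \<open>Rotating and cutting loops\<close>

lemma val_rotate:
  assumes "u \<in> words" "v \<in> words" "val (u @ v) = \<one>"
  shows "val (v @ u) = \<one>"
  using assms by (simp add: val_append val_closed) (metis inv_comm val_closed)

text \<open>The loop \<open>a @ b\<close> is cut along the chord \<open>c\<close>, whose two
  traversals cancel.\<close>

lemma area_le_split:
  assumes "R \<subseteq> words" "a \<in> words" "b \<in> words" "c \<in> words"
    and "area_le G X H R m (a @ inv_word G c)" "area_le G X H R n (c @ b)"
  shows "area_le G X H R (m + n) (a @ b)"
proof (rule area_le_cong)
  show "area_le G X H R (m + n) ((a @ inv_word G c) @ (c @ b))"
    using assms by (intro area_le_append) (auto simp: rel_words_append inv_word_words)
  show "((a @ inv_word G c) @ (c @ b), a @ b) \<in> free_rel"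
    using free_rel_context[OF free_rel_inv_word_left[OF assms(4)] assms(2,3)] by simp
qed

subsection \<open>Dehn's algorithm\<close>

text \<open>If all short subwords of a long closed word were geodesic, the point of the loop farthest from
  the base point, together with two points of the loop on either side of it, would violate
  hyperbolicity.\<close>

lemma short_nongeodesic_subword:
  assumes "gromov_hyperbolic (carrier G) (\<lambda>u v. real (wdist u v))"
  obtains k where "\<And>w. w \<in> words \<Longrightarrow> val w = \<one> \<Longrightarrow> k < length w \<Longrightarrow>
    \<exists>u v z v'. w = u @ v @ z \<and> v' \<in> words \<and> val v' = val v \<and> length v' < length v \<and> length v \<le> k"
proof -
  obtain \<delta> where \<delta>: "\<And>a x y z. a \<in> carrier G \<Longrightarrow> x \<in> carrier G \<Longrightarrow> y \<in> carrier G \<Longrightarrow> z \<in> carrier G \<Longrightarrow>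
      min (gromov_product (\<lambda>u v. real (wdist u v)) a x y) (gromov_product (\<lambda>u v. real (wdist u v)) a y z) - \<delta>
        \<le> gromov_product (\<lambda>u v. real (wdist u v)) a x z"
    using assms unfolding gromov_hyperbolic_def by blast
  obtain m :: nat where m: "2 * \<delta> < m" using reals_Archimedean2 by blast
  have "\<exists>u v z v'. w = u @ v @ z \<and> v' \<in> words \<and> val v' = val v \<and> length v' < length v \<and> length v \<le> 2 * m"
    if w: "w \<in> words" "val w = \<one>" "2 * m < length w" for w
  proof (rule ccontr)
    assume neg: "\<not> ?thesis"
    define n where "n = length w"
    define c where "c = (\<lambda>i. \<one> \<otimes> val (take i w))"
    have c: "c i \<in> carrier G" for i using take_words[OF w(1)] val_closed by (simp add: c_def)
    have ends: "c 0 = \<one>" "c n = \<one>" using w by (simp_all add: c_def n_def)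
    have upper: "wdist (c i) (c j) \<le> j - i" if "i \<le> j" "j \<le> n" for i j
      using wdist_prefixes[OF w(1) one_closed that(1)] that by (simp add: c_def n_def)
    have geodesic: "wdist (c i) (c j) = j - i" if ij: "i \<le> j" "j \<le> n" "j - i \<le> 2 * m" for i j
    proof (rule ccontr)
      assume "wdist (c i) (c j) \<noteq> j - i"
      then have less: "wdist (c i) (c j) < j - i" using upper[OF ij(1,2)] by simp
      define v where "v = drop i (take j w)"
      have ij_split: "take j w = take i w @ v"
        unfolding v_def using ij(1) by (metis append_take_drop_id min.absorb1 take_take)
      then have w_split: "w = take i w @ v @ drop j w" by (metis append.assoc append_take_drop_id)
      have words: "take i w \<in> words" "v \<in> words"
        using w(1) w_split rel_words_append by metis+
      obtain v' where v': "v' \<in> words" "length v' = wdist (c i) (c j)" "c i \<otimes> val v' = c j"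
        using wdist_word[OF c c] by metis
      have "c j = c i \<otimes> val v"
        using words val_closed by (simp add: c_def ij_split val_append)
      then have "val v' = val v" using v' c words val_closed by (metis Units_eq Units_l_cancel)
      moreover have "length v = j - i" using ij unfolding v_def n_def by simp
      ultimately show False using neg less v' ij(3) w_split by metis
    qed
    define D where "D = (\<lambda>i. wdist \<one> (c i))"
    have "Max (D ` {..n}) \<in> D ` {..n}" by (intro Max_in) auto
    then obtain t where t: "t \<le> n" "D t = Max (D ` {..n})" by (metis atMost_iff imageE)
    have Dmax: "D i \<le> D t" if "i \<le> n" for i using t that by auto
    \<comment> \<open>The vertex with index \<open>2 * m\<close> is at distance \<open>2 * m\<close>
      from the base point, so the farthest vertex is at least \<open>2 * m\<close> steps from both
      ends of the loop; this leaves room for \<open>t - m\<close> and \<open>t + m\<close>.\<close>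
    have "2 * m \<le> D t"
      using Dmax[of "2 * m"] geodesic[of 0 "2 * m"] w(3) ends by (simp add: D_def n_def)
    moreover have "D t \<le> t" using upper[of 0 t] t ends by (simp add: D_def)
    moreover have "D t \<le> n - t"
      using upper[OF t(1) order_refl] wdist_sym_le[OF c[of t] one_closed] unfolding D_def ends(2)
      by linarith
    ultimately have tm: "2 * m \<le> t" "t + 2 * m \<le> n" using t(1) by linarith+
    have dists: "wdist (c (t - m)) (c t) = m" "wdist (c t) (c (t + m)) = m"
      "wdist (c (t - m)) (c (t + m)) = 2 * m"
      using geodesic[of "t - m" t] geodesic[of t "t + m"] geodesic[of "t - m" "t + m"] tm by auto
    have D_eq: "wdist (c i) \<one> = D i" for i
      using wdist_sym_le c by (simp add: D_def antisym)
    define x y z where "x = real (D (t - m))" and "y = real (D t)" and "z = real (D (t + m))"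
    have "x \<le> y" "z \<le> y" using Dmax tm by (auto simp: x_def y_def z_def)
    \<comment> \<open>Depending on the minimum, this says
      \<open>y + m - 2 * \<delta> \<le> z\<close> or \<open>y + m - 2 * \<delta> \<le> x\<close>. As
      \<open>m\<close> exceeds \<open>2 * \<delta>\<close>, it contradicts the maximality of
      \<open>y\<close>.\<close>
    moreover have "min ((x + y - m) / 2) ((y + z - m) / 2) - \<delta> \<le> (x + z - 2 * m) / 2"
      using \<delta>[OF one_closed c[of "t - m"] c[of t] c[of "t + m"]]
      by (simp add: gromov_product_def dists D_eq x_def y_def z_def)
    ultimately show False
      using m by (auto simp: min_def field_simps split: if_splits)
  qed
  then show thesis using that by blast
qed

text \<open>Replacing \<open>v\<close> by \<open>v'\<close> costs the area of the loop
  \<open>v @ inv_word G v'\<close>, whose length is below \<open>2 * k\<close>, and shortens the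
  word by at least one letter.\<close>

lemma linear_area:
  assumes R: "R \<subseteq> words"
    and dehn: "\<And>w. w \<in> words \<Longrightarrow> val w = \<one> \<Longrightarrow> k < length w \<Longrightarrow>
      \<exists>u v z v'. w = u @ v @ z \<and> v' \<in> words \<and> val v' = val v \<and> length v' < length v \<and> length v \<le> k"
    and short: "\<And>w. w \<in> words \<Longrightarrow> val w = \<one> \<Longrightarrow> length w \<le> 2 * k \<Longrightarrow> area_le G X H R m w"
    and "w \<in> words" "val w = \<one>"
  shows "area_le G X H R (m * length w) w"
  using assms(4,5)
proof (induction "length w" arbitrary: w rule: less_induct)
  case less
  show ?case
  proof (cases "length w \<le> k")
    case True
    show ?thesis
    proof (cases "w = []")
      case False
      then have "m \<le> m * length w" by (cases w) auto
      then show ?thesis using area_le_mono[OF short] less.prems True by auto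
    qed (simp add: area_le_Nil)
  next
    case False
    then obtain u v z v' where w: "w = u @ v @ z" and v': "v' \<in> words" "val v' = val v"
      "length v' < length v" "length v \<le> k"
      using dehn less.prems by (metis not_le)
    have uvz: "u \<in> words" "v \<in> words" "z \<in> words" using less.prems w by (auto simp: rel_words_append)
    have "area_le G X H R m (v @ inv_word G v')"
      using v' uvz by (intro short)
        (auto simp: rel_words_append inv_word_words val_append val_inv_word val_closed)
    moreover have "area_le G X H R (m * length (v' @ z @ u)) (v' @ z @ u)"
    proof (rule less.hyps)
      have "val ((v @ z) @ u) = \<one>"
        using val_rotate[of u "v @ z"] less.prems w uvz by (simp add: rel_words_append)
      then show "val (v' @ z @ u) = \<one>" using v' uvz by (simp add: val_append rel_words_append)
    qed (use v' uvz w in \<open>auto simp: rel_words_append\<close>)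
    ultimately have "area_le G X H R (m + m * length (v' @ z @ u)) (v @ z @ u)"
      using area_le_split[OF R uvz(2) _ v'(1)] uvz by (simp add: rel_words_append)
    moreover have "m + m * length (v' @ z @ u) \<le> m * length w"
    proof -
      have "m * Suc (length (v' @ z @ u)) \<le> m * length w"
        by (rule mult_le_mono2) (use v' w in auto)
      then show ?thesis by simp
    qed
    ultimately have "area_le G X H R (m * length w) ((v @ z) @ u)"
      using area_le_mono by simp
    then show ?thesis
      using area_le_rotate[OF R, of "v @ z" u] uvz w by (simp add: rel_words_append)
  qed
qed

subsection \<open>Relators with finitely many letters from the subgroup\<close>

text \<open>The distance concerns \<open>inv h\<close> because the rest of a loop after an edge
  \<open>h\<close>, read from \<open>\<one>\<close>, ends at \<open>inv h\<close>. Finiteness of the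
  ball leaves finitely many such \<open>h\<close>.\<close>

definition short_relators :: "nat \<Rightarrow> 'a rel_letter list set" where
  "short_relators n = {w \<in> words. length w \<le> n \<and> val w = \<one> \<and>
    (\<forall>h. Sub h \<in> set w \<longrightarrow> relative_dist G X H \<one> (inv h) \<le> enat n)}"

text \<open>If an edge \<open>h\<close> of a short loop is far from being closed up by an admissible path, then the rest
  of the loop contains another edge of the same coset, and the loop splits into two shorter ones.\<close>

lemma area_short_relators:
  assumes "w \<in> words" "val w = \<one>" "length w \<le> n"
  shows "area_le G X H (short_relators n) (2 ^ length w) w"
  using assms
proof (induction "length w" arbitrary: w rule: less_induct)
  case less
  have R: "short_relators n \<subseteq> words" by (auto simp: short_relators_def)
  show ?case
  proof (cases "w \<in> short_relators n")
    case True
    then show ?thesis using area_le_mono[OF area_le_relator[OF R True]] by simp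
  next
    case False
    then obtain h where h: "Sub h \<in> set w" "\<not> relative_dist G X H \<one> (inv h) \<le> enat n"
      using less.prems by (auto simp: short_relators_def)
    then obtain A B where w: "w = A @ Sub h # B" by (meson split_list)
    then have AB: "A \<in> words" "B \<in> words" "h \<in> H"
      using less.prems rel_words_Cons[of "Sub h" B X H] by (auto simp: rel_words_append rel_words_letter)
    then have hc: "h \<in> carrier G" using H_subset by blast
    have Sub_h: "[Sub h] \<in> words" "val [Sub h] = h"
      using AB hc by (auto simp: rel_words_letter val_Cons)
    have rotated: "val (B @ A @ [Sub h]) = \<one>"
      using val_rotate[of "A @ [Sub h]" B] less.prems w AB Sub_h by (simp add: rel_words_append)
    then have closed: "val (B @ A) \<otimes> h = \<one>"
      using AB Sub_h hc by (simp add: val_append rel_words_append m_assoc val_closed)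
    then have "\<one> \<otimes> val (B @ A) = inv h"
      using AB hc val_closed[of "B @ A"] by (simp add: rel_words_append inv_equality)
    \<comment> \<open>Otherwise \<open>B @ A\<close> would trace an admissible path from
      \<open>\<one>\<close> to \<open>inv h\<close> of length at most \<open>n\<close>.\<close>
    then have "\<not> (\<forall>u h v. B @ A = u @ Sub h # v \<longrightarrow> \<one> \<otimes> val u \<notin> H)"
      using h(2) less.prems(3) AB w relative_dist_le_iff[of \<one> "inv h" n]
      by (auto simp: rel_words_append dest!: bspec[where x = "B @ A"])
    then obtain P l Q where PQ: "B @ A = P @ Sub l # Q" "\<one> \<otimes> val P \<in> H" by blast
    then have "P @ Sub l # Q \<in> words" using AB by (metis rel_words_append)
    then have words: "P \<in> words" "Q \<in> words" "l \<in> H"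
      using rel_words_Cons[of "Sub l" Q X H] by (auto simp: rel_words_append rel_words_letter)
    define p where "p = val P"
    have p: "p \<in> H" "p \<in> carrier G" "l \<in> carrier G"
      using PQ words val_closed H_subset by (auto simp: p_def)
    have len: "length w = length P + length Q + 2"
      using arg_cong[OF PQ(1), of length] w by simp
    have letters: "[Sub p] \<in> words" "[Sub l] \<in> words" "[Sub (inv p)] \<in> words"
      "[Sub (h \<otimes> p \<otimes> l)] \<in> words" "[Sub (h \<otimes> p)] \<in> words"
      using p words AB H_mult H_inv by (auto simp: rel_words_letter)
    have "val (B @ A) = val P \<otimes> (l \<otimes> val Q)"
      unfolding PQ(1) using words letters rel_words_Cons[of "Sub l" Q X H]
      by (simp add: val_append val_Cons)
    then have total: "val P \<otimes> (l \<otimes> (val Q \<otimes> h)) = \<one>"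
      using closed words p hc val_closed by (simp add: m_assoc)
    \<comment> \<open>The loop \<open>P\<close>, \<open>l\<close>, \<open>Q\<close>,
      \<open>h\<close> is cut along the edge \<open>p\<close> from its start to the end of
      \<open>P\<close>. In the second piece \<open>h\<close>, \<open>p\<close>, \<open>l\<close>
      merge into one letter, so both pieces are shorter than \<open>w\<close>.\<close>
    have 1: "area_le G X H (short_relators n) (2 ^ length (P @ [Sub (inv p)])) (P @ [Sub (inv p)])"
      by (rule less.hyps) (use words letters p len less.prems in
          \<open>auto simp: rel_words_append val_append val_Cons p_def\<close>)
    have 2: "area_le G X H (short_relators n) (2 ^ length (Sub (h \<otimes> p \<otimes> l) # Q)) (Sub (h \<otimes> p \<otimes> l) # Q)"
    proof (rule less.hyps)
      have "p \<otimes> (l \<otimes> val Q) \<otimes> h = \<one>" using total words p hc val_closed by (simp add: p_def m_assoc)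
      then have "h \<otimes> (p \<otimes> (l \<otimes> val Q)) = \<one>" using words p hc val_closed by (metis inv_comm m_closed)
      then show "val (Sub (h \<otimes> p \<otimes> l) # Q) = \<one>"
        using words p hc val_closed by (simp add: val_Cons m_assoc)
    qed (use words letters len less.prems rel_words_Cons in auto)
    have "([Sub h, Sub p, Sub l] @ Q, [Sub (h \<otimes> p \<otimes> l)] @ Q) \<in> free_rel"
    proof (rule free_prod_rel.trans)
      show "([Sub h, Sub p, Sub l] @ Q, [Sub (h \<otimes> p), Sub l] @ Q) \<in> free_rel"
        using free_prod_rel.sub_mult[of "[]" X H "Sub l # Q" h p G] AB p words letters
          rel_words_Cons[of "Sub l" Q X H] by (simp add: rel_words_Nil)
      show "([Sub (h \<otimes> p), Sub l] @ Q, [Sub (h \<otimes> p \<otimes> l)] @ Q) \<in> free_rel"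
        using free_prod_rel.sub_mult[of "[]" X H Q "h \<otimes> p" l G] AB p words H_mult
        by (simp add: rel_words_Nil)
    qed
    then have "area_le G X H (short_relators n) (2 ^ length (Sub (h \<otimes> p \<otimes> l) # Q)) ([Sub h] @ (Sub p # Sub l # Q))"
      using area_le_cong[OF 2] free_prod_rel.sym by fastforce
    then have 3: "area_le G X H (short_relators n) (2 ^ length (Sub (h \<otimes> p \<otimes> l) # Q)) ([Sub p] @ (Sub l # Q @ [Sub h]))"
      using area_le_rotate[OF R Sub_h(1), of "Sub p # Sub l # Q"] words letters
        rel_words_Cons[of "Sub p" "Sub l # Q" X H] rel_words_Cons[of "Sub l" Q X H] by simp
    have tail: "Sub l # Q @ [Sub h] \<in> words"
      using words letters Sub_h rel_words_Cons[of "Sub l" "Q @ [Sub h]" X H] by (simp add: rel_words_append)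
    have "inv_word G [Sub p] = [Sub (inv p)]" by (simp add: inv_word_def)
    from area_le_split[OF R words(1) tail letters(1) _ 3, unfolded this, OF 1]
    have "area_le G X H (short_relators n)
        (2 ^ length (P @ [Sub (inv p)]) + 2 ^ length (Sub (h \<otimes> p \<otimes> l) # Q)) (P @ Sub l # Q @ [Sub h])" .
    moreover have "(2::nat) ^ length (P @ [Sub (inv p)]) + 2 ^ length (Sub (h \<otimes> p \<otimes> l) # Q) \<le> 2 ^ length w"
    proof -
      have "(2::nat) ^ length (P @ [Sub (inv p)]) \<le> 2 ^ (length w - 1)"
        "(2::nat) ^ length (Sub (h \<otimes> p \<otimes> l) # Q) \<le> 2 ^ (length w - 1)"
        using len by (intro power_increasing; simp)+
      moreover have "(2::nat) ^ length w = 2 ^ (length w - 1) + 2 ^ (length w - 1)"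
        using len by (simp add: mult_2[symmetric])
      ultimately show ?thesis by linarith
    qed
    moreover have "P @ Sub l # Q @ [Sub h] = B @ (A @ [Sub h])" using PQ(1) by simp
    ultimately have "area_le G X H (short_relators n) (2 ^ length w) (B @ (A @ [Sub h]))"
      using area_le_mono by metis
    moreover have "A @ [Sub h] \<in> words" using AB Sub_h by (simp add: rel_words_append)
    ultimately have "area_le G X H (short_relators n) (2 ^ length w) ((A @ [Sub h]) @ B)"
      using area_le_rotate[OF R AB(2)] by blast
    then show ?thesis using w by simp
  qed
qed

lemma cls_mem_normal:
  assumes R: "R \<subseteq> words" and N: "N \<lhd> FP" "cls ` R \<subseteq> N" and area: "area_le G X H R n w"
  shows "cls w \<in> N"
proof -
  interpret N: normal N FP by (rule N(1))
  obtain cs where cs: "set cs \<subseteq> conjugates_pm FP (cls ` R)" "cls w = foldr (mult FP) cs \<one>\<^bsub>FP\<^esub>"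
    using area unfolding area_le_def by blast
  have "c \<in> N" if "c \<in> set cs" for c
  proof -
    have "c \<in> conjugates_pm FP (cls ` R)" using that cs(1) by blast
    then obtain f r s where c: "c = inv\<^bsub>FP\<^esub> f \<otimes>\<^bsub>FP\<^esub> s \<otimes>\<^bsub>FP\<^esub> f" "f \<in> carrier FP" "r \<in> R"
      "s = cls r \<or> s = inv\<^bsub>FP\<^esub> cls r"
      by (auto simp: conjugates_pm_def)
    then have "cls r \<in> N" using N(2) by blast
    then have "s \<in> N" using c(4) N.m_inv_closed by blast
    then show ?thesis unfolding c(1) using N.inv_op_closed1[OF c(2)] by blast
  qed
  then have "set cs \<subseteq> N" by blast
  then have "foldr (mult FP) cs \<one>\<^bsub>FP\<^esub> \<in> N" by (induction cs) auto
  then show ?thesis using cs(2) by simp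
qed

lemma presentation_of_hyperbolically_embedded:
  assumes "hyperbolically_embedded G X H"
  shows "\<exists>R. relative_presentation G X H R \<and> strongly_bounded_presentation R \<and>
    (\<exists>C. relative_isoperimetric_function G X H R (\<lambda>n. C * n))"
proof -
  have hyp: "gromov_hyperbolic (carrier G) (\<lambda>u v. real (wdist u v))"
    and fin: "finite {k \<in> H. relative_dist G X H \<one> k \<le> enat n}" for n
    using assms hyperbolic_graph_iff H_one unfolding hyperbolically_embedded_def by blast+
  obtain k where dehn: "\<And>w. w \<in> words \<Longrightarrow> val w = \<one> \<Longrightarrow> k < length w \<Longrightarrow>
      \<exists>u v z v'. w = u @ v @ z \<and> v' \<in> words \<and> val v' = val v \<and> length v' < length v \<and> length v \<le> k"
    using short_nongeodesic_subword[OF hyp] by metis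
  \<comment> \<open>Length \<open>2 * k\<close> suffices for the loops
    \<open>v @ inv_word G v'\<close> that occur in Dehn's algorithm.\<close>
  define R where "R = short_relators (2 * k)"
  have R: "R \<subseteq> words" "\<And>r. r \<in> R \<Longrightarrow> val r = \<one>" by (auto simp: R_def short_relators_def)
  have "area_le G X H R (2 ^ (2 * k)) w" if "w \<in> words" "val w = \<one>" "length w \<le> 2 * k" for w
    unfolding R_def
    using area_le_mono[OF area_short_relators[OF that]] that R by (simp add: R_def)
  from linear_area[OF R(1) dehn this]
  have area: "area_le G X H R (2 ^ (2 * k) * length w) w" if "w \<in> words" "val w = \<one>" for w
    using that by blast
  interpret nat: group_hom FP G "natural_map G" by (rule group_hom_natural_map)
  have "relative_presentation G X H R"
    unfolding relative_presentation_def
  proof (intro conjI)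
    show "kernel FP G (natural_map G) = normal_closure FP (cls ` R)"
    proof
      show "kernel FP G (natural_map G) \<subseteq> normal_closure FP (cls ` R)"
        unfolding normal_closure_def hull_def
      proof (intro subsetI InterI)
        fix A N assume A: "A \<in> kernel FP G (natural_map G)" and N: "N \<in> {t. t \<lhd> FP \<and> cls ` R \<subseteq> t}"
        obtain w where w: "w \<in> words" "A = cls w"
          using A by (auto simp: kernel_def carrier_free_prod)
        then have "val w = \<one>" using A kernel_iff by blast
        then show "A \<in> N" using cls_mem_normal[OF R(1) _ _ area] N w by blast
      qed
      show "normal_closure FP (cls ` R) \<subseteq> kernel FP G (natural_map G)"
        unfolding normal_closure_def
        using nat.normal_kernel R kernel_iff by (intro hull_minimal) auto
    qed
  qed (use R natural_map_epi in auto)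
  moreover have "strongly_bounded_presentation R"
    unfolding strongly_bounded_presentation_def bounded_presentation_def
  proof
    show "\<exists>N. \<forall>r\<in>R. length r \<le> N" by (auto simp: R_def short_relators_def)
    have "{h. \<exists>r\<in>R. Sub h \<in> set r} \<subseteq> m_inv G ` {l \<in> H. relative_dist G X H \<one> l \<le> enat (2 * k)}"
    proof
      fix h assume "h \<in> {h. \<exists>r\<in>R. Sub h \<in> set r}"
      then obtain r where r: "r \<in> R" "Sub h \<in> set r" by blast
      then have "h \<in> H" using R(1) by (auto simp: rel_words_def)
      then have "inv h \<in> H" "h = inv (inv h)" using H_inv H_subset by auto
      moreover have "relative_dist G X H \<one> (inv h) \<le> enat (2 * k)"
        using r by (simp add: R_def short_relators_def)
      ultimately show "h \<in> m_inv G ` {l \<in> H. relative_dist G X H \<one> l \<le> enat (2 * k)}" by blast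
    qed
    then show "finite {h. \<exists>r\<in>R. Sub h \<in> set r}" using fin by (rule finite_surj[rotated])
  qed
  moreover have "relative_isoperimetric_function G X H R (\<lambda>n. 2 ^ (2 * k) * n)"
    unfolding relative_isoperimetric_function_def
  proof (intro allI ballI impI, elim conjE)
    fix n w assume w: "w \<in> words" "length w \<le> n" "val w = \<one>"
    have "area_le G X H R (2 ^ (2 * k) * n) w"
      using area_le_mono[OF area[OF w(1,3)]] w(2) by simp
    then show "\<exists>cs. set cs \<subseteq> conjugates_pm FP (cls ` R) \<and> length cs \<le> 2 ^ (2 * k) * n \<and>
        cls w = foldr (mult FP) cs \<one>\<^bsub>FP\<^esub>"
      unfolding area_le_def .
  qed
  ultimately show ?thesis by blast
qed

subsection \<open>Filling loops with relators\<close>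

text \<open>For a letter from \<open>H\<close> the minimum extends over the whole coset, so that all edges of the coset
  have the same level.\<close>

fun edge_level :: "('a \<Rightarrow> nat) \<Rightarrow> 'a \<Rightarrow> 'a rel_letter \<Rightarrow> nat" where
  "edge_level g x (Gen y) = min (g x) (g (x \<otimes> y))"
| "edge_level g x (Gen_inv y) = min (g x) (g (x \<otimes> inv y))"
| "edge_level g x (Sub h) = (LEAST m. \<exists>k\<in>H. g (x \<otimes> k) = m)"

lemma edge_level_eq:
  assumes "x \<in> carrier G"
  shows "y \<in> X \<Longrightarrow> edge_level g x (Gen y) = edge_level g (x \<otimes> y) (Gen_inv y)"
    and "k \<in> H \<Longrightarrow> edge_level g x (Sub h) = edge_level g (x \<otimes> k) (Sub l)"
proof -
  show "edge_level g x (Gen y) = edge_level g (x \<otimes> y) (Gen_inv y)" if "y \<in> X"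
    using that X_subset assms by (auto simp: m_assoc min.commute subset_iff)
  assume k: "k \<in> H"
  have "(\<exists>j\<in>H. g (x \<otimes> k \<otimes> j) = m) \<longleftrightarrow> (\<exists>j\<in>H. g (x \<otimes> j) = m)" for m
  proof
    assume "\<exists>j\<in>H. g (x \<otimes> k \<otimes> j) = m"
    then show "\<exists>j\<in>H. g (x \<otimes> j) = m" using k H_mult H_subset assms m_assoc by metis
  next
    assume "\<exists>j\<in>H. g (x \<otimes> j) = m"
    then obtain j where j: "j \<in> H" "g (x \<otimes> j) = m" by blast
    have "x \<otimes> k \<otimes> (inv k \<otimes> j) = x \<otimes> j"
      using k j H_subset assms by (simp add: m_assoc) (simp flip: m_assoc)
    then show "\<exists>j\<in>H. g (x \<otimes> k \<otimes> j) = m"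
      using k j H_mult H_inv by (intro bexI[of _ "inv k \<otimes> j"]) auto
  qed
  then show "edge_level g x (Sub h) = edge_level g (x \<otimes> k) (Sub l)" by simp
qed

lemma wdist_letter:
  assumes "x \<in> carrier G" "[a] \<in> words"
  shows "wdist x (x \<otimes> lval a) \<le> 1" "wdist (x \<otimes> lval a) x \<le> 1"
proof -
  show le: "wdist x (x \<otimes> lval a) \<le> 1"
    using wdist_le[OF assms(2), of x] lval_closed[OF assms(2)] by (simp add: val_Cons)
  show "wdist (x \<otimes> lval a) x \<le> 1"
    using wdist_sym_le[of x "x \<otimes> lval a"] le assms lval_closed by simp
qed

text \<open>Vertices of one coset are at distance at most 1, so even a minimum over an infinite
  coset loses at most 1.\<close>

lemma edge_level_bounds:
  assumes g: "cayley.lipschitz g" and x: "x \<in> carrier G" and a: "[a] \<in> words"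
  shows "edge_level g x a \<le> g x" "g x \<le> edge_level g x a + 1"
proof -
  have step: "g x \<le> g (x \<otimes> lval b) + 1" if "[b] \<in> words" for b
    using g x lval_closed[OF that] wdist_letter[OF x that] unfolding cayley.lipschitz_def
    by (meson add_le_cancel_left le_trans m_closed)
  have "edge_level g x a \<le> g x \<and> g x \<le> edge_level g x a + 1" using a
  proof (cases rule: rel_letter_cases)
    case (3 h)
    have ex: "\<exists>m. \<exists>k\<in>H. g (x \<otimes> k) = m" using H_one by blast
    have "edge_level g x a \<le> g x"
      unfolding 3 edge_level.simps by (rule Least_le) (use H_one x in force)
    moreover obtain k where "k \<in> H" "g (x \<otimes> k) = edge_level g x a"
      unfolding 3 edge_level.simps using LeastI_ex[OF ex] by blast
    ultimately show ?thesis using step[of "Sub k"] by (simp add: rel_words_letter)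
  qed (use step[OF a] in auto)
  then show "edge_level g x a \<le> g x" "g x \<le> edge_level g x a + 1" by auto
qed

lemma walk_word:
  assumes "cayley.walk p as q" "p \<in> carrier G"
  obtains w where "w \<in> words" "length w \<le> length as" "p \<otimes> val w = q"
    "\<And>u v. w = u @ v \<Longrightarrow> p \<otimes> val u \<in> set (p # as)"
proof -
  have "\<exists>w\<in>words. length w \<le> length as \<and> p \<otimes> val w = q \<and> (\<forall>u v. w = u @ v \<longrightarrow> p \<otimes> val u \<in> set (p # as))"
    using assms
  proof (induction as arbitrary: p)
    case Nil
    then show ?case by (intro bexI[of _ "[]"]) (auto simp: rel_words_Nil)
  next
    case (Cons z as)
    then have z: "z \<in> carrier G" "wdist p z \<le> 1" by auto
    have "cayley.walk z as q" using Cons.prems by simp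
    from Cons.IH[OF this z(1)]
    obtain w where w: "w \<in> words" "length w \<le> length as" "z \<otimes> val w = q"
      "\<And>u v. w = u @ v \<Longrightarrow> z \<otimes> val u \<in> set (z # as)"
      by blast
    obtain e where e: "e \<in> words" "length e = wdist p z" "p \<otimes> val e = z"
      using wdist_word[OF Cons.prems(2) z(1)] by metis
    show ?case
    proof (intro bexI[of _ "e @ w"] conjI allI impI)
      show "p \<otimes> val (e @ w) = q"
        using e w Cons.prems(2) val_closed by (simp add: val_append flip: m_assoc)
      fix u v assume uv: "e @ w = u @ v"
      then have words: "u \<in> words" "v \<in> words" using e w rel_words_append by metis+
      show "p \<otimes> val u \<in> set (p # z # as)"
      proof (cases "length u < length e")
        case True
        then have "u = []" using e(2) z(2) by (cases u) auto
        then show ?thesis using Cons.prems(2) by simp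
      next
        case False
        then obtain u' where u': "u = e @ u'" "w = u' @ v"
          using uv by (auto simp: append_eq_append_conv2)
        then have "p \<otimes> val u = z \<otimes> val u'"
          using e words Cons.prems(2) val_closed by (simp add: rel_words_append val_append flip: m_assoc)
        then show ?thesis using w(4)[OF u'(2)] by auto
      qed
    qed (use e w z in \<open>auto simp: rel_words_append\<close>)
  qed
  then show thesis using that by blast
qed

text \<open>The ball around \<open>h\<close> in the Cayley graph with respect to \<open>Y\<close>,
  built in layers so that finiteness is immediate and an edge labelled in \<open>Y\<close> changes
  the layer by at most one.\<close>

fun letter_ball :: "'a set \<Rightarrow> 'a \<Rightarrow> nat \<Rightarrow> 'a set" where
  "letter_ball Y h 0 = {h}"
| "letter_ball Y h (Suc j) = letter_ball Y h j \<union>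
    (\<lambda>(a, y). a \<otimes> y) ` (letter_ball Y h j \<times> Y) \<union> (\<lambda>(a, y). a \<otimes> inv y) ` (letter_ball Y h j \<times> Y)"

lemma letter_ball_mono: "i \<le> j \<Longrightarrow> letter_ball Y h i \<subseteq> letter_ball Y h j"
  by (rule lift_Suc_mono_le[of "letter_ball Y h"]) auto

lemma letter_ball_step:
  assumes "b \<in> letter_ball Y h i" "y \<in> Y"
  shows "b \<otimes> y \<in> letter_ball Y h (Suc i)" "b \<otimes> inv y \<in> letter_ball Y h (Suc i)"
  using assms by (auto simp: image_iff)

lemma finite_letter_ball: "finite Y \<Longrightarrow> finite (letter_ball Y h j)"
  by (induction j) auto

context
  fixes R M C
  assumes presentation: "relative_presentation G X H R"
    and bounded: "\<And>r. r \<in> R \<Longrightarrow> length r \<le> M"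
    and isoperimetric: "relative_isoperimetric_function G X H R (\<lambda>n. C * n)"
begin

lemma relators_words: "R \<subseteq> words"
  using presentation by (simp add: relative_presentation_def)

lemma val_relator:
  assumes "r \<in> R"
  shows "val r = \<one>"
proof -
  have "cls r \<in> normal_closure FP (cls ` R)"
    unfolding normal_closure_def using hull_subset[of "cls ` R"] assms by blast
  then show ?thesis
    using presentation kernel_iff assms relators_words unfolding relative_presentation_def by blast
qed

lemma relators_filling:
  assumes "w \<in> words" "val w = \<one>" "g \<in> carrier G"
  obtains L where "L \<subseteq> carrier G \<times> R" "finite L" "card L \<le> C * length w"
    "\<And>\<phi> \<mu>. edge_function \<mu> \<Longrightarrow> weight \<phi> \<mu> g w \<noteq> 0 \<Longrightarrow> \<exists>(h, r)\<in>L. weight \<phi> \<mu> h r \<noteq> 0"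
proof -
  have "area_le G X H R (C * length w) w"
    using isoperimetric assms unfolding relative_isoperimetric_function_def area_le_def by blast
  then show thesis
    using relator_of_nonzero_weight[OF relators_words val_relator assms(1) _ assms(3)] that by metis
qed

text \<open>Each relator of the filling is represented by its base point, from which its vertices
  have distance at most \<open>M\<close>; the extra 1 is lost between the value of \<open>g\<close>
  at a vertex and the level of an edge.\<close>

lemma linear_filling_cayley: "cayley.linear_filling C (M + 1)"
  unfolding cayley.linear_filling_def
proof (intro allI impI)
  fix p as q bs
  assume p: "p \<in> carrier G" and as: "cayley.walk p as q" and bs: "cayley.walk q bs p"
  obtain v where v: "v \<in> words" "length v \<le> length as" "p \<otimes> val v = q"
    "\<And>u u'. v = u @ u' \<Longrightarrow> p \<otimes> val u \<in> set (p # as)"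
    using walk_word[OF as p] by metis
  have q: "q \<in> carrier G" using v p val_closed by blast
  obtain w where w: "w \<in> words" "length w \<le> length bs" "q \<otimes> val w = p"
    "\<And>u u'. w = u @ u' \<Longrightarrow> q \<otimes> val u \<in> set (q # bs)"
    using walk_word[OF bs q] by metis
  have vw: "v @ w \<in> words" using v w by (simp add: rel_words_append)
  have "p \<otimes> val (v @ w) = p" using v w p val_closed by (simp add: val_append flip: m_assoc)
  then have "val (v @ w) = \<one>" using p vw val_closed by simp
  from relators_filling[OF vw this p]
  obtain L where L: "L \<subseteq> carrier G \<times> R" "finite L" "card L \<le> C * length (v @ w)"
    "\<And>\<phi> \<mu>. edge_function \<mu> \<Longrightarrow> weight \<phi> \<mu> p (v @ w) \<noteq> 0 \<Longrightarrow> \<exists>(h, r)\<in>L. weight \<phi> \<mu> h r \<noteq> 0"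
    by metis
  have "card (fst ` L) \<le> C * length (v @ w)" using L(2,3) card_image_le le_trans by blast
  also have "\<dots> \<le> C * (length as + length bs)" using v w by (intro mult_le_mono2) auto
  finally have card: "card (fst ` L) \<le> C * (length as + length bs)" .
  have "\<exists>x\<in>fst ` L. f x \<le> t + (M + 1) \<and> t \<le> f x + (M + 1) \<and> g x \<le> s + (M + 1) \<and> s \<le> g x + (M + 1)"
    if f: "cayley.lipschitz f" and g: "cayley.lipschitz g" and ft: "f p \<le> t" "t < f q"
      and gs: "\<forall>x\<in>set (p # as). g x < s"
      and far: "\<forall>x\<in>set (q # bs). f x < t \<or> t + 1 < f x \<or> s + 1 < g x" for f g t s
  proof -
    \<comment> \<open>The weight counts, with sign, the crossings of \<open>f = t + 1/2\<close> at
      height at most \<open>s\<close>, that is, of a half-line issuing from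
      \<open>(t + 1/2, s + 1/2)\<close>; on closed paths this is the winding number up to
      sign.\<close>
    define \<phi> :: "'a \<Rightarrow> int" where "\<phi> = (\<lambda>x. if t < f x then 1 else 0)"
    define \<mu> :: "'a \<Rightarrow> 'a rel_letter \<Rightarrow> int" where "\<mu> = (\<lambda>x a. if edge_level g x a \<le> s then 1 else 0)"
    have edge: "edge_function \<mu>"
      unfolding edge_function_def
    proof (intro conjI ballI)
      fix x y assume "x \<in> carrier G" "y \<in> X"
      from edge_level_eq(1)[OF this, of g] show "\<mu> x (Gen y) = \<mu> (x \<otimes> y) (Gen_inv y)"
        unfolding \<mu>_def by (simp only:)
    next
      fix x i j l assume "x \<in> carrier G" "j \<in> H"
      from edge_level_eq(2)[OF this, of g i l] show "\<mu> x (Sub i) = \<mu> (x \<otimes> j) (Sub l)"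
        unfolding \<mu>_def by (simp only:)
    qed
    have prefix: "u \<in> words" "[a] \<in> words" "v \<in> words" if "u @ a # v \<in> words" for u a v
      using that rel_words_append[of u "a # v" X H] rel_words_Cons[of a v X H] by auto
    have "weight \<phi> \<mu> p v = 1 * (\<phi> (p \<otimes> val v) - \<phi> p)"
    proof (rule weight_constant[OF v(1) p], rule disjI1)
      fix u a u' assume u: "v = u @ a # u'"
      then have a: "u \<in> words" "[a] \<in> words" using prefix(1,2)[OF v(1)[unfolded u]] by blast+
      have "g (p \<otimes> val u) < s" using gs v(4)[OF u] by blast
      then show "\<mu> (p \<otimes> val u) a = 1"
        using edge_level_bounds(1)[OF g _ a(2), of "p \<otimes> val u"] p a val_closed by (auto simp: \<mu>_def)
    qed
    then have weight_v: "weight \<phi> \<mu> p v = 1" using ft v(3) by (simp add: \<phi>_def)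
    \<comment> \<open>An edge of \<open>w\<close> that crosses the line starts where
      \<open>f\<close> is \<open>t\<close> or \<open>t + 1\<close>; there \<open>far\<close> gives
      \<open>s + 1 < g x\<close>, so its level is above \<open>s\<close>.\<close>
    have "weight \<phi> \<mu> q w = 0 * (\<phi> (q \<otimes> val w) - \<phi> q)"
    proof (rule weight_constant[OF w(1) q])
      fix u a u' assume u: "w = u @ a # u'"
      then have a: "u \<in> words" "[a] \<in> words" using prefix(1,2)[OF w(1)[unfolded u]] by blast+
      define x where "x = q \<otimes> val u"
      have x: "x \<in> carrier G" "x \<otimes> lval a \<in> carrier G"
        using q a val_closed lval_closed by (auto simp: x_def)
      have "f x < t \<or> t + 1 < f x \<or> s + 1 < g x" using far w(4)[OF u] unfolding x_def by blast
      moreover have "g x \<le> edge_level g x a + 1" using edge_level_bounds(2)[OF g x(1) a(2)] .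
      moreover have "f x \<le> f (x \<otimes> lval a) + 1" "f (x \<otimes> lval a) \<le> f x + 1"
        using f x wdist_letter[OF x(1) a(2)] unfolding cayley.lipschitz_def
        by (meson add_le_cancel_left le_trans)+
      ultimately show "\<mu> (q \<otimes> val u) a = 0 \<or> \<phi> (q \<otimes> val u \<otimes> lval a) = \<phi> (q \<otimes> val u)"
        unfolding \<mu>_def \<phi>_def x_def[symmetric] by auto
    qed
    then have "weight \<phi> \<mu> p (v @ w) \<noteq> 0"
      using weight_append[OF v(1) w(1) p] v(3) weight_v by simp
    then obtain h r where hr: "(h, r) \<in> L" "weight \<phi> \<mu> h r \<noteq> 0" using L(4)[OF edge, of \<phi>] by auto
    then have h: "h \<in> carrier G" and r: "r \<in> R" "r \<in> words" using L(1) relators_words by auto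
    have near: "h \<otimes> val u \<in> carrier G" "[a] \<in> words" "h \<otimes> val u \<otimes> lval a \<in> carrier G"
      "wdist h (h \<otimes> val u) \<le> M" "wdist h (h \<otimes> val u \<otimes> lval a) \<le> M"
      "wdist (h \<otimes> val u) h \<le> M" "wdist (h \<otimes> val u \<otimes> lval a) h \<le> M" if u: "r = u @ a # u'" for u a u'
    proof -
      have a: "u \<in> words" "[a] \<in> words" using prefix(1,2)[OF r(2)[unfolded u]] by blast+
      then show *: "h \<otimes> val u \<in> carrier G" "[a] \<in> words" "h \<otimes> val u \<otimes> lval a \<in> carrier G"
        using h val_closed lval_closed by auto
      show le: "wdist h (h \<otimes> val u) \<le> M"
        using wdist_le[OF a(1), of h] bounded[OF r(1)] u by simp
      have "h \<otimes> val (u @ [a]) = h \<otimes> val u \<otimes> lval a"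
        using a h val_closed lval_closed by (simp add: val_append val_Cons m_assoc)
      then show le': "wdist h (h \<otimes> val u \<otimes> lval a) \<le> M"
        using wdist_le[of "u @ [a]" h] bounded[OF r(1)] u a by (simp add: rel_words_append)
      show "wdist (h \<otimes> val u) h \<le> M" "wdist (h \<otimes> val u \<otimes> lval a) h \<le> M"
        using wdist_sym_le[OF h *(1)] wdist_sym_le[OF h *(3)] le le' by linarith+
    qed
    have lip: "k x \<le> k h + M" "k h \<le> k x + M"
      if "cayley.lipschitz k" "x \<in> carrier G" "wdist h x \<le> M" "wdist x h \<le> M" for k x
      using that h unfolding cayley.lipschitz_def by (meson add_le_cancel_left le_trans)+
    \<comment> \<open>A closed relator of nonzero weight crosses the line on both sides of the
      point: \<open>c = 0\<close> yields a crossing at level at most \<open>s\<close>, and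
      \<open>c = 1\<close> one above.\<close>
    have const: "\<exists>u a u'. r = u @ a # u' \<and> \<mu> (h \<otimes> val u) a \<noteq> c \<and>
        \<phi> (h \<otimes> val u \<otimes> lval a) \<noteq> \<phi> (h \<otimes> val u)" for c
      using weight_constant[OF r(2) h, of \<mu> c \<phi>] hr(2) val_relator[OF r(1)] h by force
    obtain u a u' where u: "r = u @ a # u'" "\<mu> (h \<otimes> val u) a \<noteq> 0"
        "\<phi> (h \<otimes> val u \<otimes> lval a) \<noteq> \<phi> (h \<otimes> val u)"
      using const[of 0] by blast
    note n = near[OF u(1)]
    have "f (h \<otimes> val u) \<le> f h + M" "f h \<le> f (h \<otimes> val u) + M"
      "f (h \<otimes> val u \<otimes> lval a) \<le> f h + M" "f h \<le> f (h \<otimes> val u \<otimes> lval a) + M"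
      using lip[OF f n(1,4,6)] lip[OF f n(3,5,7)] by auto
    then have f_near: "f h \<le> t + (M + 1)" "t \<le> f h + (M + 1)"
      using u(3) by (auto simp: \<phi>_def split: if_splits)
    have "g (h \<otimes> val u) \<le> s + 1"
      using u(2) edge_level_bounds(2)[OF g n(1,2)] by (auto simp: \<mu>_def split: if_splits)
    then have g_le: "g h \<le> s + (M + 1)" using lip(2)[OF g n(1,4,6)] by linarith
    obtain u a u' where u: "r = u @ a # u'" "\<mu> (h \<otimes> val u) a \<noteq> 1"
      using const[of 1] by blast
    note n = near[OF u(1)]
    have "s < g (h \<otimes> val u)"
      using u(2) edge_level_bounds(1)[OF g n(1,2)] by (auto simp: \<mu>_def split: if_splits)
    then have "s \<le> g h + (M + 1)" using lip(1)[OF g n(1,4,6)] by linarith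
    then show ?thesis using f_near g_le hr(1) by force
  qed
  moreover have "fst ` L \<subseteq> carrier G" "finite (fst ` L)" using L by auto
  ultimately show "\<exists>D\<subseteq>carrier G. finite D \<and> card D \<le> C * (length as + length bs) \<and>
      (\<forall>f g t s. cayley.lipschitz f \<longrightarrow> cayley.lipschitz g \<longrightarrow> f p \<le> t \<longrightarrow> t < f q \<longrightarrow>
        (\<forall>w\<in>set (p # as). g w < s) \<longrightarrow>
        (\<forall>w\<in>set (q # bs). f w < t \<or> t + 1 < f w \<or> s + 1 < g w) \<longrightarrow>
        (\<exists>v\<in>D. f v \<le> t + (M + 1) \<and> t \<le> f v + (M + 1) \<and> g v \<le> s + (M + 1) \<and> s \<le> g v + (M + 1)))"
    using card by (intro exI[of _ "fst ` L"]) blast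
qed

subsection \<open>Finiteness of balls in the subgroup\<close>

text \<open>A path from \<open>h\<close> to \<open>k\<close> outside the coset \<open>H\<close> is closed up by the single edge from \<open>k\<close> to \<open>h\<close>.
  If \<open>k\<close> is not in the ball of radius \<open>j\<close>, the indicator function of this ball has
  nonzero weight on this loop, so some relator of the filling crosses the boundary of the
  ball along an edge of \<open>H\<close>. Such an edge crosses the boundary of only one of the balls, so
  their number is at most the number of letters in the filling.\<close>

lemma ball_subset_letter_ball:
  assumes h: "h \<in> H"
  defines "Y \<equiv> {y. \<exists>r\<in>R. Sub y \<in> set r}"
  shows "{k \<in> H. relative_dist G X H h k \<le> enat n} \<subseteq> letter_ball Y h (C * (n + 1) * M)"
proof (rule subsetI, rule ccontr)
  fix k assume k: "k \<in> {k \<in> H. relative_dist G X H h k \<le> enat n}"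
    and k_far: "k \<notin> letter_ball Y h (C * (n + 1) * M)"
  \<comment> \<open>The filling has at most \<open>C * (n + 1)\<close> relators with at most
    \<open>M\<close> letters each, whereas the \<open>J + 1\<close> radii up to \<open>J\<close>
    need distinct letters.\<close>
  define J where "J = C * (n + 1) * M"
  have hc: "h \<in> carrier G" and kc: "k \<in> carrier G" and kH: "k \<in> H" using h k H_subset by auto
  obtain w where w: "w \<in> words" "length w \<le> n" "h \<otimes> val w = k"
      "\<forall>u l v. w = u @ Sub l # v \<longrightarrow> h \<otimes> val u \<notin> H"
    using k relative_dist_le_iff[OF hc] by auto
  define W where "W = w @ [Sub (inv k \<otimes> h)]"
  have kh: "inv k \<otimes> h \<in> H" "inv k \<otimes> h \<in> carrier G" "k \<otimes> (inv k \<otimes> h) = h"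
    using kH h H_mult H_inv kc hc by (auto simp flip: m_assoc)
  have last: "[Sub (inv k \<otimes> h)] \<in> words" "val [Sub (inv k \<otimes> h)] = inv k \<otimes> h"
    using kh by (auto simp: rel_words_letter val_Cons)
  have W: "W \<in> words" using w last by (simp add: W_def rel_words_append)
  have "h \<otimes> val W = k \<otimes> (inv k \<otimes> h)"
    using w last hc val_closed kh by (simp add: W_def val_append flip: m_assoc)
  then have "val W = \<one>" using kh hc W val_closed by simp
  from relators_filling[OF W this hc]
  obtain L where L: "L \<subseteq> carrier G \<times> R" "finite L" "card L \<le> C * length W"
    "\<And>\<phi> \<mu>. edge_function \<mu> \<Longrightarrow> weight \<phi> \<mu> h W \<noteq> 0 \<Longrightarrow> \<exists>(g, r)\<in>L. weight \<phi> \<mu> g r \<noteq> 0"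
    by metis
  \<comment> \<open>Only edges inside \<open>H\<close> itself count, so the admissible path
    contributes nothing and the weight of the loop is the jump of \<open>\<phi>\<close> along its
    last edge.\<close>
  define \<mu> :: "'a \<Rightarrow> 'a rel_letter \<Rightarrow> int" where
    "\<mu> = (\<lambda>g a. case a of Sub l \<Rightarrow> if g \<in> H then 1 else 0 | _ \<Rightarrow> 0)"
  have edge: "edge_function \<mu>"
    unfolding edge_function_def \<mu>_def using mult_mem_H_iff by simp
  define crosses where "crosses = (\<lambda>((g, r), i) j. \<exists>y\<in>Y. r ! i = Sub y \<and>
      (g \<otimes> val (take i r) \<in> letter_ball Y h j) \<noteq> (g \<otimes> val (take i r) \<otimes> y \<in> letter_ball Y h j) \<and>
      g \<otimes> val (take i r) \<in> carrier G)"
  have Y: "y \<in> carrier G" if "y \<in> Y" for y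
    using that relators_words H_subset unfolding Y_def rel_words_def by fastforce
  have "\<exists>e\<in>L \<times> {..<M}. crosses e j" if j: "j \<le> J" for j
  proof -
    define \<phi> :: "'a \<Rightarrow> int" where "\<phi> = (\<lambda>x. if x \<in> letter_ball Y h j then 1 else 0)"
    have "h \<in> letter_ball Y h j" using letter_ball_mono[of 0 j] by auto
    moreover have "k \<notin> letter_ball Y h j" using k_far letter_ball_mono[OF j] unfolding J_def by blast
    ultimately have \<phi>: "\<phi> h = 1" "\<phi> k = 0" by (simp_all add: \<phi>_def)
    have "weight \<phi> \<mu> h w = 0 * (\<phi> (h \<otimes> val w) - \<phi> h)"
    proof (rule weight_constant[OF w(1) hc], rule disjI1)
      fix u a v assume "w = u @ a # v"
      then show "\<mu> (h \<otimes> val u) a = 0" using w(4) by (cases a) (auto simp: \<mu>_def)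
    qed
    moreover have "weight \<phi> \<mu> k [Sub (inv k \<otimes> h)] = 1"
      using \<phi> kh kH by (simp add: \<mu>_def)
    ultimately have "weight \<phi> \<mu> h W \<noteq> 0"
      unfolding W_def using weight_append[OF w(1) last(1) hc] w(3) by simp
    then obtain g r where gr: "(g, r) \<in> L" "weight \<phi> \<mu> g r \<noteq> 0" using L(4)[OF edge, of \<phi>] by auto
    then have g: "g \<in> carrier G" and r: "r \<in> R" "r \<in> words" using L(1) relators_words by auto
    obtain u a v where u: "r = u @ a # v" "\<mu> (g \<otimes> val u) a \<noteq> 0"
        "\<phi> (g \<otimes> val u \<otimes> lval a) \<noteq> \<phi> (g \<otimes> val u)"
      using weight_constant[OF r(2) g, of \<mu> 0 \<phi>] gr(2) by force
    obtain y where y: "a = Sub y" using u(2) by (cases a) (auto simp: \<mu>_def)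
    have "Sub y \<in> set r" using u(1) y by simp
    then have "y \<in> Y" using r(1) unfolding Y_def by blast
    moreover have "u \<in> words" using r(2) u(1) by (simp add: rel_words_append)
    ultimately have "crosses ((g, r), length u) j"
      using u y g val_closed by (auto simp: crosses_def \<phi>_def split: if_splits)
    moreover have "length u < M" using bounded[OF r(1)] u(1) by simp
    ultimately show ?thesis using gr(1) by blast
  qed
  then obtain e where e: "\<And>j. j \<le> J \<Longrightarrow> e j \<in> L \<times> {..<M}" "\<And>j. j \<le> J \<Longrightarrow> crosses (e j) j"
    by metis
  have unique: "\<not> crosses x j" if cross: "crosses x i" and ij: "i < j" for x i j
  proof -
    obtain g r l where x: "x = ((g, r), l)" by (cases x) auto
    define b where "b = g \<otimes> val (take l r)"
    obtain y where y: "y \<in> Y" "r ! l = Sub y" "b \<in> carrier G"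
      "(b \<in> letter_ball Y h i) \<noteq> (b \<otimes> y \<in> letter_ball Y h i)"
      using cross unfolding crosses_def x b_def by auto
    have "b \<otimes> y \<otimes> inv y = b" using y Y by (simp add: m_assoc)
    \<comment> \<open>One end of the edge lies in the ball of radius \<open>i\<close>, so the other
      lies in the ball of radius \<open>i + 1\<close>.\<close>
    then have "b \<in> letter_ball Y h (Suc i)" "b \<otimes> y \<in> letter_ball Y h (Suc i)"
      using y(4) letter_ball_step[OF _ y(1), of _ h i] letter_ball_mono[of i "Suc i" Y h]
      by (metis le_SucI order_refl subsetD)+
    moreover have "letter_ball Y h (Suc i) \<subseteq> letter_ball Y h j"
      using ij by (intro letter_ball_mono) simp
    ultimately have "b \<in> letter_ball Y h j \<and> b \<otimes> y \<in> letter_ball Y h j" by blast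
    then show ?thesis using y(2) unfolding crosses_def x b_def case_prod_conv by fastforce
  qed
  have "inj_on e {..J}"
  proof (rule inj_onI)
    fix i j assume "i \<in> {..J}" "j \<in> {..J}" "e i = e j"
    then show "i = j" using e(2) unique by (metis atMost_iff linorder_neqE_nat)
  qed
  then have "card {..J} \<le> card (L \<times> {..<M})"
    using e(1) L(2) by (intro card_inj_on_le image_subsetI) auto
  also have "\<dots> = card L * M" by (simp add: card_cartesian_product)
  also have "\<dots> \<le> C * (n + 1) * M"
  proof (rule mult_le_mono1)
    have "C * length W \<le> C * (n + 1)" using w(2) by (intro mult_le_mono2) (simp add: W_def)
    then show "card L \<le> C * (n + 1)" using L(3) by simp
  qed
  finally show False by (simp add: J_def)
qed

end

lemma hyperbolically_embedded_of_presentation: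
  assumes "relative_presentation G X H R" "strongly_bounded_presentation R"
    and "relative_isoperimetric_function G X H R (\<lambda>n. C * n)"
  shows "hyperbolically_embedded G X H"
proof -
  obtain M where M: "\<And>r. r \<in> R \<Longrightarrow> length r \<le> M" and fin: "finite {h. \<exists>r\<in>R. Sub h \<in> set r}"
    using assms(2) unfolding strongly_bounded_presentation_def bounded_presentation_def by blast
  have "gromov_hyperbolic (carrier G) (\<lambda>u v. real (wdist u v))"
    using cayley.gromov_hyperbolic_of_filling[OF linear_filling_cayley[OF assms(1) M assms(3)]] .
  moreover have "finite {k \<in> H. relative_dist G X H h k \<le> enat n}" if "h \<in> H" for h n
    using finite_subset[OF ball_subset_letter_ball[OF assms(1) M assms(3) that]]
      finite_letter_ball[OF fin] by blast
  ultimately show ?thesis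
    unfolding hyperbolically_embedded_def hyperbolic_graph_iff using generates by blast
qed

end

theorem theorem2p3:
  fixes G :: "('a, 'm) monoid_scheme" and X H :: "'a set"
  assumes "group G"
    and "subgroup H G"
    and "X \<subseteq> carrier G"
    and "\<forall>x\<in>X. inv\<^bsub>G\<^esub> x \<in> X"
    and "generate G (X \<union> H) = carrier G"
  shows "hyperbolically_embedded G X H \<longleftrightarrow>
    (\<exists>R. relative_presentation G X H R \<and>
         strongly_bounded_presentation R \<and>
         (\<exists>C::nat. relative_isoperimetric_function G X H R (\<lambda>n. C * n)))"
proof
  interpret relative_generation G X H
    using assms by (simp add: relative_generation_def relative_generation_axioms_def)
  show "hyperbolically_embedded G X H" if "\<exists>R. relative_presentation G X H R \<and>
      strongly_bounded_presentation R \<and>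
      (\<exists>C::nat. relative_isoperimetric_function G X H R (\<lambda>n. C * n))"
    using that hyperbolically_embedded_of_presentation by blast
  show "\<exists>R. relative_presentation G X H R \<and> strongly_bounded_presentation R \<and>
      (\<exists>C::nat. relative_isoperimetric_function G X H R (\<lambda>n. C * n))"
    if "hyperbolically_embedded G X H"
    using that by (rule presentation_of_hyperbolically_embedded)
qed

end
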